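(* Let $(X,\sigma)$ be an infinite minimal one-sided shift over a finite alphabet with sublinear complexity, and let $(\bar X,\bar\sigma)$ be its two-sided version. Then: (1) For each $k\ge 2$ let $M_k$ be the number of branch points of order $k$ in $X$, and let $M:=\min\{M_k : k\ge 2,\ M_k\ge 1\}$. Then the group $\mathrm{Aut}(X,\sigma)$ has at most $M$ elements. As a consequence, any $\Phi\in\mathrm{Aut}(X,\sigma)$ has finite order at most $M$. (2) For each $k\ge 2$ let $\bar M_k$ be the number of $\sim$-equivalence classes of size $k$ (i.e. consisting of exactly $k$ orbits) in the set of right asymptotic orbits of $(\bar X,\bar\sigma)$, and let $\bar M:=\min\{\bar M_k : k\ge 2,\ \bar M_k\ge 1\}$. Then the quotient group $\mathrm{Aut}(\bar X,\bar\sigma)/\{\bar\sigma^n : n\in\mathbb Z\}$ has at most $\bar M$ elements. As a consequence, for any $\Phi\in\mathrm{Aut}(\bar X,\bar\sigma)$ there exist an integer $k$ with $1\le k\le\bar M$ and an $n\in\mathbb Z$ such that $\Phi^k=\bar\sigma^n$.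
   Context: Let $\mathcal A$ be a finite alphabet with the discrete topology and $\mathbb N_0=\{0,1,2,\dots\}$. A one-sided shift $(X,\sigma)$ is a closed shift-invariant subset $X\subseteq\mathcal A^{\mathbb N_0}$ (product topology) with the left shift $\sigma$; a two-sided shift $(\bar X,\bar\sigma)$ is a closed shift-invariant subset of $\mathcal A^{\mathbb Z}$ with the left shift $\bar\sigma$. Minimal means that every orbit (forward orbit in the one-sided case) is dense. The language $\mathcal L_X$ is the set of all finite words occurring in points of $X$. The complexity $p(n)$, $n\ge 1$, is the number of words of length $n$ in $\mathcal L_X$. The shift has sublinear complexity if $p$ is bounded above by a linear function of $n$. The two-sided version $(\bar X,\bar\sigma)$ of a one-sided minimal shift $(X,\sigma)$ is the set $\bar X$ of all bi-infinite sequences all of whose finite words lie in $\mathcal L_X$ (so that $\mathcal L_{\bar X}=\mathcal L_X$), with the shift $\bar\sigma$. An automorphism of a (one- or two-sided) shift is a continuous bijection of the space onto itself commuting with the shift map; $\mathrm{Aut}$ denotes the group of automorphisms under composition. In the two-sided case, $\{\bar\sigma^n:n\in\mathbb Z\}$ is a normal subgroup of $\mathrm{Aut}(\bar X,\bar\sigma)$. The order of $\Phi$ is the least $m\ge 1$ with $\Phi^m=\mathrm{id}$. A point $x\in X$ is a branch point of order $k>1$ if $|\sigma^{-1}(x)|=k$. Points $\bar x,\bar y\in\bar X$ are right asymptotic if there is $N\in\mathbb Z$ with $\bar x_n=\bar y_n$ for all $n\ge N$. Two orbits $\mathcal O_{\bar x}=\{\bar\sigma^n(\bar x):n\in\mathbb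 Z\}$ and $\mathcal O_{\bar y}$ are right asymptotic if there exist $\bar x'\in\mathcal O_{\bar x}$ and $\bar y'\in\mathcal O_{\bar y}$ that are right asymptotic. A single orbit $\mathcal O_{\bar x}$ is called right asymptotic if there is a point $\bar y\in\bar X$ with $\mathcal O_{\bar x}\cap\mathcal O_{\bar y}=\emptyset$ such that $\mathcal O_{\bar x}$ and $\mathcal O_{\bar y}$ are right asymptotic. On the set of right asymptotic orbits of $(\bar X,\bar\sigma)$, define the equivalence relation $\mathcal O_{\bar x}\sim\mathcal O_{\bar y}$ if $\mathcal O_{\bar x}$ and $\mathcal O_{\bar y}$ are right asymptotic. *)

theory Defs
  imports "HOL-Analysis.Analysis" "HOL-Algebra.Bij" "HOL-Algebra.Coset" "HOL-Algebra.Multiplicative_Group"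
begin

text \<open>
  Sequences over an alphabet \<open>A\<close> are functions \<open>'i \<Rightarrow> 'a\<close>, where the index type \<open>'i\<close> is
  \<open>nat\<close> for one-sided and \<open>int\<close> for two-sided shifts; notions common to both are polymorphic in \<open>'i\<close>.
\<close>

definition seq_top :: "'a set \<Rightarrow> ('i \<Rightarrow> 'a) topology" where
  "seq_top A = product_topology (\<lambda>_. discrete_topology A) UNIV"

definition shift :: "('i::semiring_1 \<Rightarrow> 'a) \<Rightarrow> 'i \<Rightarrow> 'a" where
  "shift x = (\<lambda>i. x (i + 1))"

definition one_sided_shift :: "'a set \<Rightarrow> (nat \<Rightarrow> 'a) set \<Rightarrow> bool" where
  "one_sided_shift A X \<longleftrightarrow> closedin (seq_top A) X \<and> shift ` X \<subseteq> X"

definition minimal_one_sided :: "'a set \<Rightarrow> (nat \<Rightarrow> 'a) set \<Rightarrow> bool" where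
  "minimal_one_sided A X \<longleftrightarrow>
     (\<forall>x\<in>X. subtopology (seq_top A) X closure_of {(shift ^^ n) x | n. True} = X)"

definition word_at :: "('i::semiring_1 \<Rightarrow> 'a) \<Rightarrow> 'i \<Rightarrow> nat \<Rightarrow> 'a list" where
  "word_at x i n = map (\<lambda>j. x (i + of_nat j)) [0..<n]"

definition language :: "('i::semiring_1 \<Rightarrow> 'a) set \<Rightarrow> 'a list set" where
  "language X = {word_at x i n | x i n. x \<in> X}"

definition complexity :: "('i::semiring_1 \<Rightarrow> 'a) set \<Rightarrow> nat \<Rightarrow> nat" where
  "complexity X n = card {w \<in> language X. length w = n}"

definition sublinear_complexity :: "('i::semiring_1 \<Rightarrow> 'a) set \<Rightarrow> bool" where
  "sublinear_complexity X \<longleftrightarrow>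
     (\<exists>a b :: real. \<forall>n\<ge>1. real (complexity X n) \<le> a * real n + b)"

definition two_sided_version :: "(nat \<Rightarrow> 'a) set \<Rightarrow> (int \<Rightarrow> 'a) set" where
  "two_sided_version X = {x. language {x} \<subseteq> language X}"

text \<open>
  Automorphisms are maps on \<open>X\<close>, represented by functions that are \<open>undefined\<close> outside \<open>X\<close>
  (as in \<^const>\<open>Bij\<close>), so that equal automorphisms are equal functions and the number of
  automorphisms is the cardinality of the carrier.
\<close>

definition Aut ::
  "'a set \<Rightarrow> ('i::semiring_1 \<Rightarrow> 'a) set \<Rightarrow> (('i \<Rightarrow> 'a) \<Rightarrow> ('i \<Rightarrow> 'a)) monoid" where
  "Aut A X = BijGroup X \<lparr>carrier := {\<Phi> \<in> Bij X.
     continuous_map (subtopology (seq_top A) X) (subtopology (seq_top A) X) \<Phi> \<and>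
     (\<forall>x\<in>X. \<Phi> (shift x) = shift (\<Phi> x))}\<rparr>"

definition branch_points :: "(nat \<Rightarrow> 'a) set \<Rightarrow> nat \<Rightarrow> (nat \<Rightarrow> 'a) set" where
  "branch_points X k = {x \<in> X. card {y \<in> X. shift y = x} = k}"

text \<open>\<open>zshift n\<close> is the \<open>n\<close>-th power of the two-sided shift, for \<open>n\<close> of either sign.\<close>

definition zshift :: "int \<Rightarrow> (int \<Rightarrow> 'a) \<Rightarrow> int \<Rightarrow> 'a" where
  "zshift n x = (\<lambda>i. x (i + n))"

lemma zshift_one: "zshift 1 = shift"
  and zshift_zero: "zshift 0 = id"
  and zshift_add: "zshift (m + n) = zshift m \<circ> zshift n"
  by (auto simp: fun_eq_iff zshift_def shift_def algebra_simps)

definition shift_powers :: "(int \<Rightarrow> 'a) set \<Rightarrow> ((int \<Rightarrow> 'a) \<Rightarrow> (int \<Rightarrow> 'a)) set" where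
  "shift_powers X = {restrict (zshift n) X | n. True}"

definition orbit :: "(int \<Rightarrow> 'a) \<Rightarrow> (int \<Rightarrow> 'a) set" where
  "orbit x = {zshift n x | n. True}"

definition right_asymptotic :: "(int \<Rightarrow> 'a) \<Rightarrow> (int \<Rightarrow> 'a) \<Rightarrow> bool" where
  "right_asymptotic x y \<longleftrightarrow> (\<exists>N. \<forall>n\<ge>N. x n = y n)"

definition orbits_right_asymptotic :: "(int \<Rightarrow> 'a) set \<Rightarrow> (int \<Rightarrow> 'a) set \<Rightarrow> bool" where
  "orbits_right_asymptotic P Q \<longleftrightarrow> (\<exists>x\<in>P. \<exists>y\<in>Q. right_asymptotic x y)"

definition asymptotic_orbits :: "(int \<Rightarrow> 'a) set \<Rightarrow> (int \<Rightarrow> 'a) set set" where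
  "asymptotic_orbits X = {orbit x | x. x \<in> X \<and>
     (\<exists>y\<in>X. orbit x \<inter> orbit y = {} \<and> orbits_right_asymptotic (orbit x) (orbit y))}"

definition asymptotic_rel :: "(int \<Rightarrow> 'a) set \<Rightarrow> ((int \<Rightarrow> 'a) set \<times> (int \<Rightarrow> 'a) set) set" where
  "asymptotic_rel X = {(P, Q). P \<in> asymptotic_orbits X \<and> Q \<in> asymptotic_orbits X \<and>
     orbits_right_asymptotic P Q}"

definition asymptotic_classes :: "(int \<Rightarrow> 'a) set \<Rightarrow> nat \<Rightarrow> (int \<Rightarrow> 'a) set set set" where
  "asymptotic_classes X k = {c \<in> asymptotic_orbits X // asymptotic_rel X. card c = k}"

text \<open>
  \<open>min_count F\<close> is the minimum of the numbers \<open>card (F k)\<close> that are at least 1, over \<open>k \<ge> 2\<close>.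
  It is meaningful only if all these \<open>F k\<close> are finite (\<^const>\<open>card\<close> being 0 on infinite sets)
  and some \<open>F k\<close> is nonempty, which is what \<open>counts_ok\<close> says.
\<close>

definition counts_ok :: "(nat \<Rightarrow> 'b set) \<Rightarrow> bool" where
  "counts_ok F \<longleftrightarrow> (\<forall>k\<ge>2. finite (F k)) \<and> (\<exists>k\<ge>2. card (F k) \<ge> 1)"

definition min_count :: "(nat \<Rightarrow> 'b set) \<Rightarrow> nat" where
  "min_count F = (LEAST m. m \<in> {card (F k) | k. k \<ge> 2 \<and> card (F k) \<ge> 1})"

end

theory Submission
  imports Defs
begin

text \<open>
  Distinct branching points have distinct left special prefixes, so \<open>K\<close> of them force
  \<open>p(n + 1) \<ge> p(n) + K\<close> for all large \<open>n\<close>; sublinear complexity therefore leaves only finitely many.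
  An automorphism permutes the branch points of each order, and by minimality it is determined by
  the image of a single point, which gives part (1). In part (2) an automorphism permutes the
  asymptotic classes of each size. If \<open>\<Phi>\<close> and \<open>\<Psi>\<close> send an orbit into the same class, then for some
  \<open>n\<close> the points \<open>\<Phi> x\<close> and \<open>\<sigma>\<^sup>n (\<Psi> x)\<close> are right asymptotic; the forward orbit of \<open>x\<close> being dense,
  continuity of the coordinate at 0 forces \<open>\<Phi> = \<sigma>\<^sup>n \<circ> \<Psi>\<close>.
\<close>

subsection \<open>Cylinder sets\<close>

text \<open>Both bounds count where an automorphism can send one fixed object, so each needs a
  finite, nonempty set of possible targets. The obstacle in part (2) is that an invertible shift has
  no branch points. The way back to \<open>X\<close> is that a bi-infinite sequence lies in
  \<open>two_sided_version X\<close> exactly when all its right tails lie in \<open>X\<close>. If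
  two such sequences agree from some coordinate on, but not from the one before it, the common tail
  has two preimages and is a branching point. Conversely, two preimages of a branching point extend
  to the left to bi-infinite sequences; their orbits are disjoint because an infinite minimal shift
  has no eventually periodic point. Sublinear complexity thus enters both parts through a single
  fact, the finiteness of \<open>branching X\<close>. Evaluation at a branch point is injective on
  automorphisms; its analogue in part (2) separates only the cosets of the shift powers.\<close>

lemma topspace_seq_top: "topspace (seq_top A) = {x. \<forall>i. x i \<in> A}"
  by (auto simp: seq_top_def)

lemma Hausdorff_seq_top: "Hausdorff_space (subtopology (seq_top A) X)"
  unfolding seq_top_def
  by (intro Hausdorff_space_subtopology) (simp add: Hausdorff_space_product_topology)

lemma compact_seq_top: "finite A \<Longrightarrow> compact_space (seq_top A)"
  unfolding seq_top_def by (simp add: compact_space_product_topology compact_space_discrete_topology)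

lemma continuous_map_coord:
  "continuous_map (subtopology (seq_top A) X) (discrete_topology A) (\<lambda>x. x i)"
  unfolding seq_top_def
  by (intro continuous_map_from_subtopology continuous_map_product_projection) simp

lemma openin_cylinder:
  assumes "finite F"
  shows "openin (seq_top A) {x \<in> topspace (seq_top A). \<forall>i\<in>F. x i = z i}"
proof -
  have "openin (seq_top A) {x \<in> topspace (seq_top A). x i \<in> {z i} \<inter> A}" for i
    using continuous_map_coord[of A UNIV i]
    by (intro openin_continuous_map_preimage[of _ "discrete_topology A"]) auto
  then have *: "openin (seq_top A) {x \<in> topspace (seq_top A). x i = z i}" for i
    by (rule back_subst[of "openin _"]) (auto simp: topspace_seq_top)
  from assms show ?thesis
  proof (induction F)
    case (insert i F)
    have "{x \<in> topspace (seq_top A). \<forall>j\<in>insert i F. x j = z j}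
      = {x \<in> topspace (seq_top A). x i = z i} \<inter> {x \<in> topspace (seq_top A). \<forall>j\<in>F. x j = z j}"
      by auto
    then show ?case using * insert.IH by (simp add: openin_Int)
  qed (use openin_topspace[of "seq_top A"] in simp)
qed

lemma openin_seq_top_cylinder:
  assumes "openin (seq_top A) U" "z \<in> U"
  obtains F where "finite F" "\<And>y. y \<in> topspace (seq_top A) \<Longrightarrow> \<forall>i\<in>F. y i = z i \<Longrightarrow> y \<in> U"
proof -
  have "\<forall>x\<in>U. \<exists>V. finite {i. V i \<noteq> A} \<and> (\<forall>i. V i \<subseteq> A) \<and> x \<in> Pi\<^sub>E UNIV V \<and> Pi\<^sub>E UNIV V \<subseteq> U"
    using assms(1) unfolding seq_top_def openin_product_topology_alt by simp
  then obtain V where V: "finite {i. V i \<noteq> A}" "z \<in> Pi\<^sub>E UNIV V" "Pi\<^sub>E UNIV V \<subseteq> U"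
    using assms(2) by blast
  show ?thesis
  proof (rule that[OF V(1)])
    fix y assume "y \<in> topspace (seq_top A)" "\<forall>i\<in>{i. V i \<noteq> A}. y i = z i"
    then have "y i \<in> V i" for i
      using V(2) by (cases "V i = A") (auto simp: topspace_seq_top PiE_iff)
    then show "y \<in> U" using V(3) by (auto simp: PiE_iff)
  qed
qed

text \<open>Cylinders over finite coordinate sets form a neighbourhood basis. Density and closedness
  are used below in this combinatorial form.\<close>

lemma in_closure_seq_top:
  assumes "S \<subseteq> X" "X \<subseteq> topspace (seq_top A)"
  shows "z \<in> subtopology (seq_top A) X closure_of S \<longleftrightarrow>
    z \<in> X \<and> (\<forall>F. finite F \<longrightarrow> (\<exists>s\<in>S. \<forall>i\<in>F. s i = z i))" (is "?L \<longleftrightarrow> ?R")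
proof
  assume L: ?L
  then have z: "z \<in> X" by (auto simp: in_closure_of)
  have "\<exists>s\<in>S. \<forall>i\<in>F. s i = z i" if "finite F" for F
  proof -
    have "openin (subtopology (seq_top A) X) (X \<inter> {x \<in> topspace (seq_top A). \<forall>i\<in>F. x i = z i})"
      by (intro openin_subtopology_Int2 openin_cylinder that)
    moreover have "z \<in> X \<inter> {x \<in> topspace (seq_top A). \<forall>i\<in>F. x i = z i}"
      using z assms(2) by auto
    ultimately have "\<exists>y. y \<in> S \<and> y \<in> X \<inter> {x \<in> topspace (seq_top A). \<forall>i\<in>F. x i = z i}"
      using L unfolding in_closure_of by meson
    then show ?thesis by auto
  qed
  with z show ?R by blast
next
  assume R: ?R
  have "\<exists>y\<in>S. y \<in> T" if T: "z \<in> T" "openin (subtopology (seq_top A) X) T" for T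
  proof -
    obtain U where U: "openin (seq_top A) U" "T = U \<inter> X"
      using T(2) by (auto simp: openin_subtopology)
    obtain F where F: "finite F" "\<And>y. y \<in> topspace (seq_top A) \<Longrightarrow> \<forall>i\<in>F. y i = z i \<Longrightarrow> y \<in> U"
      using openin_seq_top_cylinder U T(1) by (metis IntD1)
    obtain s where "s \<in> S" "\<forall>i\<in>F. s i = z i" using R F(1) by blast
    then show ?thesis using F(2) U(2) assms by blast
  qed
  moreover have "z \<in> topspace (subtopology (seq_top A) X)" using R assms(2) by auto
  ultimately show ?L unfolding in_closure_of by blast
qed

lemma closedin_seq_top_iff:
  "closedin (seq_top A) X \<longleftrightarrow> X \<subseteq> topspace (seq_top A) \<and>
     (\<forall>z\<in>topspace (seq_top A). (\<forall>F. finite F \<longrightarrow> (\<exists>s\<in>X. \<forall>i\<in>F. s i = z i)) \<longrightarrow> z \<in> X)"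
proof (cases "X \<subseteq> topspace (seq_top A)")
  case True
  have "closedin (seq_top A) X \<longleftrightarrow> seq_top A closure_of X \<subseteq> X"
    using True closure_of_subset_eq[of X "seq_top A"] by simp
  also have "seq_top A closure_of X =
      {z \<in> topspace (seq_top A). \<forall>F. finite F \<longrightarrow> (\<exists>s\<in>X. \<forall>i\<in>F. s i = z i)}"
    by (intro Set.set_eqI) (use in_closure_seq_top[OF True order_refl] in \<open>simp add: subtopology_topspace\<close>)
  finally show ?thesis using True by auto
qed (auto dest: closedin_subset)

text \<open>A continuous map to a discrete space is locally constant, and compactness makes the
  local windows uniform. Applied to one coordinate of an automorphism, this is the sliding block
  code description of Curtis, Hedlund and Lyndon.\<close>

lemma continuous_map_finite_window:
  assumes "finite A" "closedin (seq_top A) X"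
    and f: "continuous_map (subtopology (seq_top A) X) (discrete_topology B) f"
  obtains F where "finite F"
    "\<And>x y. x \<in> X \<Longrightarrow> y \<in> X \<Longrightarrow> \<forall>i\<in>F. x i = y i \<Longrightarrow> f x = f y"
proof -
  have XA: "X \<subseteq> topspace (seq_top A)" using assms(2) closedin_subset by blast
  have fB: "f x \<in> B" if "x \<in> X" for x
    using f that XA by (auto simp: continuous_map_def Pi_iff)
  have "\<exists>F. finite F \<and> (\<forall>y\<in>X. (\<forall>i\<in>F. y i = z i) \<longrightarrow> f y = f z)" if "z \<in> X" for z
  proof -
    have "openin (subtopology (seq_top A) X) {y \<in> topspace (subtopology (seq_top A) X). f y \<in> {f z}}"
      using fB[OF that] by (intro openin_continuous_map_preimage[OF f]) auto
    then obtain U where U: "openin (seq_top A) U"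
      "{y \<in> topspace (subtopology (seq_top A) X). f y \<in> {f z}} = U \<inter> X"
      by (auto simp: openin_subtopology)
    then have "z \<in> U" using that XA by auto
    obtain F where F: "finite F" "\<And>y. y \<in> topspace (seq_top A) \<Longrightarrow> \<forall>i\<in>F. y i = z i \<Longrightarrow> y \<in> U"
      using openin_seq_top_cylinder[OF U(1) \<open>z \<in> U\<close>] by metis
    then show ?thesis using U(2) XA by blast
  qed
  then obtain W where W: "\<And>z. z \<in> X \<Longrightarrow> finite (W z)"
    "\<And>z y. z \<in> X \<Longrightarrow> y \<in> X \<Longrightarrow> \<forall>i\<in>W z. y i = z i \<Longrightarrow> f y = f z"
    by metis
  \<comment> \<open>On the cylinder \<open>C z\<close> the map \<open>f\<close> has the constant
    value \<open>f z\<close>. Finitely many cylinders cover \<open>X\<close>, and the union of their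
    windows is the required \<open>F\<close>: it forces \<open>y\<close> into the same cylinder as
    \<open>x\<close>.\<close>
  define C where "C z = {y \<in> topspace (seq_top A). \<forall>i\<in>W z. y i = z i}" for z
  have "compactin (seq_top A) X"
    using assms compact_seq_top closedin_compact_space by blast
  then have "\<exists>K. finite K \<and> K \<subseteq> C ` X \<and> X \<subseteq> \<Union>K"
    unfolding compactin_def
  proof (elim conjE allE[of _ "C ` X"] mp, intro conjI)
    show "Ball (C ` X) (openin (seq_top A))"
      using W(1) by (auto simp: C_def intro: openin_cylinder)
    show "X \<subseteq> \<Union>(C ` X)" using XA by (auto simp: C_def)
  qed
  then obtain K where K: "finite K" "K \<subseteq> C ` X" "X \<subseteq> \<Union>K" by (elim exE conjE)
  obtain Z where Z: "finite Z" "Z \<subseteq> X" "K = C ` Z"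
    using finite_subset_image[OF K(1,2)] by metis
  show ?thesis
  proof (rule that[of "\<Union>(W ` Z)"])
    show "finite (\<Union>(W ` Z))" using Z(1) W(1) subsetD[OF Z(2)] by simp
    fix x y assume xy: "x \<in> X" "y \<in> X" "\<forall>i\<in>\<Union>(W ` Z). x i = y i"
    obtain z where z: "z \<in> Z" "x \<in> C z" using subsetD[OF K(3) xy(1)] Z(3) by auto
    have zX: "z \<in> X" using Z(2) z(1) by (rule subsetD)
    have xz: "\<forall>i\<in>W z. x i = z i" using z(2) by (simp add: C_def)
    then have yz: "\<forall>i\<in>W z. y i = z i" using xy(3) z(1) by simp
    have "f x = f z" by (rule W(2)[OF zX xy(1) xz])
    moreover have "f y = f z" by (rule W(2)[OF zX xy(2) yz])
    ultimately show "f x = f y" by simp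
  qed
qed

subsection \<open>The automorphism group\<close>

lemma carrier_Aut: "carrier (Aut A X) = {\<Phi> \<in> Bij X.
     continuous_map (subtopology (seq_top A) X) (subtopology (seq_top A) X) \<Phi> \<and>
     (\<forall>x\<in>X. \<Phi> (shift x) = shift (\<Phi> x))}"
  by (simp add: Aut_def)

lemma group_Aut:
  assumes "finite A" "closedin (seq_top A) X" "shift ` X \<subseteq> X"
  shows "group (Aut A X)"
proof -
  let ?T = "subtopology (seq_top A) X"
  let ?H = "carrier (Aut A X)"
  have topX: "topspace ?T = X" using closedin_subset[OF assms(2)] by auto
  have comp: "compact_space ?T"
    using assms compact_seq_top closedin_compact_space compact_space_subtopology by blast
  have inB: "f ` X = X" "inj_on f X" "\<And>x. x \<in> X \<Longrightarrow> f x \<in> X" "f \<in> extensional X" if "f \<in> Bij X" for f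
    using that by (auto simp: Bij_def bij_betw_def)
  have "subgroup ?H (BijGroup X)"
  proof (rule group.subgroupI[OF group_BijGroup])
    show "?H \<subseteq> carrier (BijGroup X)" by (auto simp: carrier_Aut BijGroup_def)
    have "(\<lambda>x\<in>X. x) \<in> ?H"
      using assms(3) id_Bij[of X] topX
      by (auto simp: carrier_Aut image_subset_iff intro: continuous_map_eq[OF continuous_map_id])
    then show "?H \<noteq> {}" by blast
  next
    fix f g assume fg: "f \<in> ?H" "g \<in> ?H"
    then have B: "f \<in> Bij X" "g \<in> Bij X" by (auto simp: carrier_Aut)
    have "continuous_map ?T ?T (f \<circ> g)"
      using fg by (auto simp: carrier_Aut intro: continuous_map_compose)
    then have "continuous_map ?T ?T (compose X f g)"
      by (rule continuous_map_eq) (simp add: topX compose_def)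
    then show "f \<otimes>\<^bsub>BijGroup X\<^esub> g \<in> ?H"
      using fg B compose_Bij[OF B] assms(3) inB(3)
      by (simp add: BijGroup_def carrier_Aut image_subset_iff) (simp add: compose_def)
  next
    fix f assume f: "f \<in> ?H"
    then have B: "f \<in> Bij X" by (auto simp: carrier_Aut)
    define g where "g = (\<lambda>x\<in>X. inv_into X f x)"
    have g: "g x \<in> X" "f (g x) = x" "g (f x) = x" if "x \<in> X" for x
      using inB[OF B] that by (auto simp: g_def inv_into_into f_inv_into_f)
    \<comment> \<open>Continuity of the inverse is not part of the definition of \<open>Aut\<close>;
      it comes from compactness of the domain and the Hausdorff property of the target.\<close>
    have "homeomorphic_map ?T ?T f"
      by (rule continuous_imp_homeomorphic_map[OF _ comp Hausdorff_seq_top])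
        (use f inB[OF B] topX in \<open>auto simp: carrier_Aut\<close>)
    then obtain h where h: "homeomorphic_maps ?T ?T f h"
      using homeomorphic_map_maps by blast
    then have hc: "continuous_map ?T ?T h" by (simp add: homeomorphic_maps_def)
    have "h x = g x" if "x \<in> topspace ?T" for x
    proof -
      have "h (f (g x)) = g x" using h g(1) that topX by (simp add: homeomorphic_maps_def)
      then show ?thesis using g(2) that topX by simp
    qed
    then have gc: "continuous_map ?T ?T g" using continuous_map_eq[OF hc] by blast
    have "g (shift x) = shift (g x)" if "x \<in> X" for x
    proof -
      have "f (shift (g x)) = shift x" using f g that by (simp add: carrier_Aut)
      moreover have "shift (g x) \<in> X" using g(1) that assms(3) by blast
      ultimately show ?thesis using g(3) by metis
    qed
    then have "g \<in> ?H" using gc B restrict_inv_into_Bij[OF B] by (auto simp: carrier_Aut g_def)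
    then show "inv\<^bsub>BijGroup X\<^esub> f \<in> ?H" using inv_BijGroup[OF B] by (simp add: g_def)
  qed
  then have "group (BijGroup X\<lparr>carrier := ?H\<rparr>)"
    by (rule subgroup.subgroup_is_group[OF _ group_BijGroup])
  then show ?thesis by (simp add: Aut_def)
qed

lemma mult_Aut:
  "\<lbrakk>f \<in> carrier (Aut A X); g \<in> carrier (Aut A X)\<rbrakk> \<Longrightarrow> f \<otimes>\<^bsub>Aut A X\<^esub> g = compose X f g"
  by (auto simp: Aut_def BijGroup_def)

lemma one_Aut: "\<one>\<^bsub>Aut A X\<^esub> = restrict id X"
  by (auto simp: Aut_def BijGroup_def)

text \<open>Pigeonhole: the exponents \<open>0..m\<close> are \<open>m + 1\<close> many, so two
  powers of \<open>g\<close> share a coset, and their quotient is a power with exponent between 1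
  and \<open>m\<close>.\<close>

lemma (in group) pow_in_subgroup_finite_index:
  assumes H: "subgroup H G" and fin: "finite (rcosets H)" and card: "card (rcosets H) \<le> m"
    and g: "g \<in> carrier G"
  shows "\<exists>k::nat. 1 \<le> k \<and> k \<le> m \<and> g [^] k \<in> H"
proof -
  let ?c = "\<lambda>k::nat. H #> g [^] k"
  have "?c ` {0..m} \<subseteq> rcosets H"
    using g H by (auto intro!: rcosetsI subgroup.subset)
  then have "card (?c ` {0..m}) \<le> m" using card card_mono[OF fin] by (meson le_trans)
  then have "\<not> inj_on ?c {0..m}" using card_image[of ?c "{0..m}"] by auto
  then obtain i j where ij: "i < j" "j \<le> m" "?c i = ?c j"
    unfolding inj_on_def by (metis atLeastAtMost_iff linorder_neqE_nat)
  have "g [^] j \<in> H #> g [^] i"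
    using ij(3) rcos_self[OF _ H] g by simp
  then obtain h where h: "h \<in> H" "g [^] j = h \<otimes> g [^] i" by (auto simp: r_coset_def)
  have hG: "h \<in> carrier G" using h(1) H subgroup.mem_carrier by metis
  have "g [^] (j - i) \<otimes> g [^] i = h \<otimes> g [^] i"
    using h(2) ij(1) g by (simp add: nat_pow_mult)
  then have "g [^] (j - i) = h" using g hG by simp
  then show ?thesis using ij h(1) by (intro exI[of _ "j - i"] conjI) simp_all
qed

lemma (in group) ord_le_card:
  assumes "finite (carrier G)" "g \<in> carrier G"
  shows "0 < ord g \<and> ord g \<le> card (carrier G)"
  using assms ord_ge_1[of g] ord_le_group_order[of g] by (simp add: order_def)

lemma min_count_attained:
  assumes "counts_ok F"
  obtains k where "k \<ge> 2" "card (F k) = min_count F" "F k \<noteq> {}" "finite (F k)"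
proof -
  have "min_count F \<in> {card (F k) | k. k \<ge> 2 \<and> card (F k) \<ge> 1}"
    unfolding min_count_def by (rule LeastI_ex) (use assms in \<open>auto simp: counts_ok_def\<close>)
  then obtain k where k: "k \<ge> 2" "card (F k) = min_count F" "card (F k) \<ge> 1" by auto
  show ?thesis using k assms by (intro that[of k]) (auto simp: counts_ok_def)
qed

subsection \<open>Branching points of a minimal shift\<close>

text \<open>One prefix length separates all points of the set at once: go past a chosen coordinate
  of disagreement for every pair.\<close>

lemma finite_set_prefix_distinct:
  fixes S :: "(nat \<Rightarrow> 'a) set"
  assumes "finite S"
  obtains m where "\<And>x y. x \<in> S \<Longrightarrow> y \<in> S \<Longrightarrow> \<forall>i<m. x i = y i \<Longrightarrow> x = y"
proof -
  have "\<forall>p\<in>S \<times> S. \<exists>i. fst p \<noteq> snd p \<longrightarrow> fst p i \<noteq> snd p i" by (auto simp: fun_eq_iff)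
  then obtain d where d: "\<And>x y. x \<in> S \<Longrightarrow> y \<in> S \<Longrightarrow> x \<noteq> y \<Longrightarrow> x (d (x, y)) \<noteq> y (d (x, y))"
    by (metis SigmaI fst_conv snd_conv)
  show ?thesis
  proof (rule that[of "Suc (Max (d ` (S \<times> S)))"])
    fix x y assume xy: "x \<in> S" "y \<in> S" "\<forall>i<Suc (Max (d ` (S \<times> S))). x i = y i"
    have "d (x, y) \<le> Max (d ` (S \<times> S))" using xy assms by (intro Max_ge) auto
    then show "x = y" using d[OF xy(1,2)] xy(3) by (metis le_imp_less_Suc)
  qed
qed

lemma funpow_shift: "(shift ^^ n) x = (\<lambda>i::nat. x (i + n))"
  by (induction n) (auto simp: shift_def)

lemma eq_if_shift_eq:
  fixes x y :: "nat \<Rightarrow> 'a"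
  assumes "shift x = shift y" "x 0 = y 0"
  shows "x = y"
proof
  fix i
  show "x i = y i"
    using assms(2) fun_cong[OF assms(1), of "i - 1"] by (cases i) (simp_all add: shift_def)
qed

text \<open>The union of the branch points of all orders at least 2, stated without cardinalities.
  That it is this union rests on fibres of the shift being finite; see
  \<open>branch_points_sub\<close> and \<open>branching_order\<close>.\<close>

definition branching :: "(nat \<Rightarrow> 'a) set \<Rightarrow> (nat \<Rightarrow> 'a) set" where
  "branching X = {x \<in> X. \<exists>y\<in>X. \<exists>z\<in>X. y \<noteq> z \<and> shift y = x \<and> shift z = x}"

locale infinite_minimal_shift =
  fixes A :: "'a set" and X :: "(nat \<Rightarrow> 'a) set"
  assumes finite_alphabet: "finite A"
    and one_sided: "one_sided_shift A X"
    and infinite_shift: "infinite X"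
    and minimal: "minimal_one_sided A X"
begin

lemma closed_X: "closedin (seq_top A) X"
  using one_sided by (simp add: one_sided_shift_def)

lemma X_sub: "X \<subseteq> topspace (seq_top A)"
  using closed_X closedin_subset by blast

lemma letter_in: "x \<in> X \<Longrightarrow> x i \<in> A"
  using X_sub by (auto simp: topspace_seq_top)

lemma shift_in: "x \<in> X \<Longrightarrow> shift x \<in> X"
  using one_sided by (auto simp: one_sided_shift_def)

lemma funpow_shift_in: "x \<in> X \<Longrightarrow> (shift ^^ n) x \<in> X"
  by (induction n) (auto intro: shift_in)

lemma in_X_if_prefixes:
  assumes "\<And>n. \<exists>s\<in>X. \<forall>i<n. s i = z i"
  shows "z \<in> X"
proof -
  have "z i \<in> A" for i
    using assms[of "Suc i"] letter_in by (metis lessI)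
  moreover have "\<exists>s\<in>X. \<forall>i\<in>F. s i = z i" if "finite F" for F
    using assms[of "Suc (Max F)"] that by (metis Max_ge le_imp_less_Suc)
  ultimately show ?thesis
    using closed_X unfolding closedin_seq_top_iff by (simp add: topspace_seq_top)
qed

lemma orbit_sub: "x \<in> X \<Longrightarrow> {(shift ^^ n) x | n. True} \<subseteq> X"
  using funpow_shift_in by blast

lemma recurrent:
  assumes "x \<in> X" "z \<in> X"
  shows "\<exists>m. \<forall>i<n. x (m + i) = z i"
proof -
  have "z \<in> subtopology (seq_top A) X closure_of {(shift ^^ n) x | n. True}"
    using minimal assms by (auto simp: minimal_one_sided_def)
  then have "\<exists>s\<in>{(shift ^^ n) x | n. True}. \<forall>i\<in>{..<n}. s i = z i"
    using in_closure_seq_top[OF orbit_sub[OF assms(1)] X_sub] by blast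
  then show ?thesis by (auto simp: funpow_shift add.commute)
qed

text \<open>Every prefix of \<open>z\<close> occurs somewhere preceded by a letter. As the alphabet
  is finite, one letter serves prefixes of all lengths, and closedness puts that letter followed by
  \<open>z\<close> into \<open>X\<close>.\<close>

lemma shift_surj:
  assumes "z \<in> X"
  obtains y where "y \<in> X" "shift y = z"
proof -
  have "\<exists>a\<in>A. \<forall>n. \<exists>s\<in>X. \<forall>i<n. s i = case_nat a z i"
  proof (rule ccontr)
    assume "\<not> ?thesis"
    then obtain N where N: "\<And>a s. a \<in> A \<Longrightarrow> s \<in> X \<Longrightarrow> \<exists>i < N a. s i \<noteq> case_nat a z i"
      by metis
    obtain x where x: "x \<in> X" using infinite_shift by fastforce
    \<comment> \<open>Searching in \<open>shift x\<close> instead of \<open>x\<close> guarantees a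
      letter in front of the occurrence, namely \<open>x m\<close>, which is \<open>s 0\<close>
      below. The maximum of \<open>N\<close> makes the occurrence long enough for whichever letter
      this is.\<close>
    obtain m where m: "\<forall>i < Max (N ` A). shift x (m + i) = z i"
      using recurrent[OF shift_in[OF x] assms] by blast
    define s where "s = (shift ^^ m) x"
    have s: "s \<in> X" unfolding s_def by (rule funpow_shift_in[OF x])
    obtain i where i: "i < N (s 0)" "s i \<noteq> case_nat (s 0) z i"
      using N[OF letter_in[OF s] s] by blast
    then obtain j where j: "i = Suc j" by (cases i) auto
    have "N (s 0) \<le> Max (N ` A)" using finite_alphabet letter_in[OF s] by simp
    then have "shift x (m + j) = z j" using m i(1) j by simp
    then show False using i(2) j by (simp add: s_def funpow_shift shift_def add.commute)
  qed
  then obtain a where "case_nat a z \<in> X" using in_X_if_prefixes by blast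
  moreover have "shift (case_nat a z) = z" by (auto simp: shift_def)
  ultimately show ?thesis using that by blast
qed

text \<open>A repetition would make the forward orbit finite, hence closed; being dense, it would be
  all of the infinite set \<open>X\<close>.\<close>

lemma aperiodic:
  assumes "x \<in> X" "(shift ^^ i) x = (shift ^^ j) x"
  shows "i = j"
proof (rule ccontr)
  assume "i \<noteq> j"
  then obtain p q where pq: "p < q" "(shift ^^ p) x = (shift ^^ q) x"
    using assms(2) by (metis linorder_neqE_nat)
  have per: "(shift ^^ (n + p)) x = (shift ^^ (n + q)) x" for n
    using pq(2) by (simp add: funpow_add)
  have "(shift ^^ n) x \<in> (\<lambda>n. (shift ^^ n) x) ` {..<q}" for n
  proof (induction n rule: less_induct)
    case (less n)
    show ?case
    proof (cases "n < q")
      case False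
      then have "(shift ^^ n) x = (shift ^^ (n - q + p)) x" using per[of "n - q"] by simp
      then show ?thesis using less[of "n - q + p"] False pq(1) by simp
    qed auto
  qed
  then have "{(shift ^^ n) x | n. True} \<subseteq> (\<lambda>n. (shift ^^ n) x) ` {..<q}" by blast
  then have fin: "finite {(shift ^^ n) x | n. True}" using finite_surj finite_lessThan by blast
  have "subtopology (seq_top A) X closure_of {(shift ^^ n) x | n. True} = {(shift ^^ n) x | n. True}"
    unfolding closure_of_eq
    by (rule closedin_Hausdorff_finite[OF Hausdorff_seq_top _ fin])
      (use orbit_sub[OF assms(1)] X_sub in \<open>simp add: subset_iff\<close>)
  then show False using fin minimal assms(1) infinite_shift by (auto simp: minimal_one_sided_def)
qed

lemma continuous_map_shift:
  "continuous_map (subtopology (seq_top A) X) (subtopology (seq_top A) X) shift"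
proof -
  have "continuous_map (subtopology (seq_top A) X) (seq_top A) shift"
    unfolding seq_top_def[of A, where 'i = nat] continuous_map_componentwise_UNIV
    using continuous_map_coord[of A X, unfolded seq_top_def] by (simp add: shift_def)
  then show ?thesis
    using shift_in by (auto simp: continuous_map_in_subtopology)
qed

text \<open>
  If the shift were injective, compactness would make the first letter of a point a function of the
  next \<open>n\<close> letters, so a window of length \<open>n\<close> would determine everything to its left and \<open>X\<close>
  would have at most \<open>card A ^ n\<close> points.
\<close>

lemma not_inj_shift: "\<not> inj_on shift X"
proof
  assume inj: "inj_on shift X"
  let ?T = "subtopology (seq_top A) X"
  have top: "topspace ?T = X" using X_sub by auto
  have "compact_space ?T"
    using closed_X compact_seq_top[OF finite_alphabet] closedin_compact_space compact_space_subtopology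
    by blast
  moreover have "shift ` X = X" using shift_in shift_surj by (metis image_subset_iff subsetI subset_antisym rev_image_eqI)
  ultimately have "homeomorphic_map ?T ?T shift"
    using continuous_imp_homeomorphic_map[OF continuous_map_shift _ Hausdorff_seq_top] inj top by metis
  then obtain h where h: "homeomorphic_maps ?T ?T shift h"
    using homeomorphic_map_maps by blast
  have "continuous_map ?T (discrete_topology A) ((\<lambda>x. x 0) \<circ> h)"
    using h by (intro continuous_map_compose[OF _ continuous_map_coord[of A X]]) (simp add: homeomorphic_maps_def)
  from continuous_map_finite_window[OF finite_alphabet closed_X this]
  obtain F where F: "finite F"
    "\<And>x y. x \<in> X \<Longrightarrow> y \<in> X \<Longrightarrow> \<forall>i\<in>F. x i = y i \<Longrightarrow> ((\<lambda>x. x 0) \<circ> h) x = ((\<lambda>x. x 0) \<circ> h) y"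
    by blast
  have hs: "h (shift x) = x" if "x \<in> X" for x
    using h that top by (simp add: homeomorphic_maps_def)
  define n where "n = Suc (Max F)"
  have det: "x 0 = y 0" if "x \<in> X" "y \<in> X" "\<forall>i<n. x (Suc i) = y (Suc i)" for x y
  proof -
    have "\<forall>i\<in>F. shift x i = shift y i"
    proof
      fix i assume "i \<in> F"
      then have "i < n" using F(1) by (simp add: n_def le_imp_less_Suc)
      then show "shift x i = shift y i" using that(3) by (simp add: shift_def)
    qed
    from F(2)[OF shift_in[OF that(1)] shift_in[OF that(2)] this]
    show ?thesis using hs that by simp
  qed
  obtain S where S: "S \<subseteq> X" "finite S" "card S = Suc (card A ^ n)"
    using infinite_shift infinite_arbitrarily_large by blast
  obtain m where m: "\<And>x y. x \<in> S \<Longrightarrow> y \<in> S \<Longrightarrow> \<forall>i<m. x i = y i \<Longrightarrow> x = y"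
    using finite_set_prefix_distinct[OF S(2)] by blast
  \<comment> \<open>The window begins at \<open>m\<close>, where the separating prefixes end. Two
    points of \<open>S\<close> with the same window then agree on everything to its left, which
    includes a separating prefix.\<close>
  define w where "w x = map x [m..<m + n]" for x :: "nat \<Rightarrow> 'a"
  have "w ` S \<subseteq> {l. set l \<subseteq> A \<and> length l = n}"
    using letter_in subsetD[OF S(1)] by (auto simp: w_def)
  then have "card (w ` S) \<le> card A ^ n"
    using card_mono[OF finite_lists_length_eq[OF finite_alphabet]]
      card_lists_length_eq[OF finite_alphabet] by metis
  then have "\<not> inj_on w S" using card_image[of w S] S(3) by auto
  then obtain x y where xy: "x \<in> S" "y \<in> S" "x \<noteq> y" "w x = w y" by (auto simp: inj_on_def)
  have wxy: "x i = y i" if "m \<le> i" "i < m + n" for i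
    using xy(4) that by (auto simp: w_def)
  have "\<forall>i. m - k \<le> i \<and> i < m + n \<longrightarrow> x i = y i" for k
  proof (induction k)
    case (Suc k)
    show ?case
    proof (cases "m \<le> k")
      case False
      define j where "j = m - Suc k"
      have j: "Suc j = m - k" using False by (simp add: j_def)
      have "(shift ^^ j) x 0 = (shift ^^ j) y 0"
      proof (rule det)
        show "(shift ^^ j) x \<in> X" "(shift ^^ j) y \<in> X" using xy S(1) funpow_shift_in by blast+
        show "\<forall>i<n. (shift ^^ j) x (Suc i) = (shift ^^ j) y (Suc i)"
          using Suc j by (auto simp: funpow_shift)
      qed
      then have "x j = y j" by (simp add: funpow_shift)
      then show ?thesis using Suc j unfolding j_def[symmetric] by (metis le_neq_implies_less Suc_leI)
    qed (use Suc in auto)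
  qed (use wxy in auto)
  from this[of m] have "x = y" using m[OF xy(1,2)] by simp
  then show False using xy(3) by simp
qed

lemma branching_nonempty: "branching X \<noteq> {}"
proof -
  obtain y z where yz: "y \<in> X" "z \<in> X" "shift y = shift z" "y \<noteq> z"
    using not_inj_shift unfolding inj_on_def by auto
  then have "shift y \<in> branching X" using shift_in[OF yz(1)] unfolding branching_def by auto
  then show ?thesis by auto
qed

text \<open>A preimage is determined by its first letter.\<close>

lemma finite_preimages: "finite {y \<in> X. shift y = x}"
proof (rule finite_imageD[of "\<lambda>y. y 0"])
  show "finite ((\<lambda>y. y 0) ` {y \<in> X. shift y = x})"
    by (rule finite_subset[OF _ finite_alphabet]) (use letter_in in auto)
  show "inj_on (\<lambda>y. y 0) {y \<in> X. shift y = x}"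
    by (rule inj_onI, rule eq_if_shift_eq) simp_all
qed

lemma branch_points_sub: "k \<ge> 2 \<Longrightarrow> branch_points X k \<subseteq> branching X"
proof
  fix x assume k: "k \<ge> 2" and "x \<in> branch_points X k"
  then have x: "x \<in> X" "card {y \<in> X. shift y = x} = k" by (auto simp: branch_points_def)
  have "\<not> card {y \<in> X. shift y = x} \<le> Suc 0" using x k by simp
  then show "x \<in> branching X"
    using x(1) finite_preimages card_le_Suc0_iff_eq[OF finite_preimages, of x]
    by (auto simp: branching_def)
qed

lemma branching_order:
  assumes "x \<in> branching X"
  shows "x \<in> branch_points X (card {y \<in> X. shift y = x}) \<and> card {y \<in> X. shift y = x} \<ge> 2"
proof -
  have "\<not> card {y \<in> X. shift y = x} \<le> Suc 0"
    using assms card_le_Suc0_iff_eq[OF finite_preimages, of x] by (auto simp: branching_def)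
  then show ?thesis using assms by (auto simp: branching_def branch_points_def)
qed

section \<open>Word complexity and finiteness of the set of branching points\<close>

lemma words_of_length: "{w \<in> language X. length w = n} = (\<lambda>x. map x [0..<n]) ` X"
proof (intro Set.set_eqI iffI)
  fix w assume "w \<in> {w \<in> language X. length w = n}"
  then obtain x i where "x \<in> X" "w = word_at x i n"
    unfolding language_def by (auto simp: word_at_def simp del: map_eq_conv)
  then have "w = map ((shift ^^ i) x) [0..<n]" "(shift ^^ i) x \<in> X"
    by (auto simp: word_at_def funpow_shift add.commute intro: funpow_shift_in[unfolded funpow_shift])
  then show "w \<in> (\<lambda>x. map x [0..<n]) ` X" by blast
next
  fix w assume "w \<in> (\<lambda>x. map x [0..<n]) ` X"
  then obtain x where x: "x \<in> X" "w = word_at x 0 n" by (auto simp: word_at_def)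
  then have "w \<in> language X" unfolding language_def by blast
  then show "w \<in> {w \<in> language X. length w = n}" using x(2) by (simp add: word_at_def)
qed

text \<open>
  Deleting the first letter maps words of length \<open>n + 1\<close> onto words of length \<open>n\<close>, and the prefix of
  a branching point has at least two preimages.
\<close>

lemma complexity_Suc:
  assumes "S \<subseteq> branching X" "finite S"
    and dist: "\<And>x y. x \<in> S \<Longrightarrow> y \<in> S \<Longrightarrow> \<forall>i<n. x i = y i \<Longrightarrow> x = y"
  shows "complexity X n + card S \<le> complexity X (Suc n)"
proof -
  define P where "P n x = map x [0..<n]" for n and x :: "nat \<Rightarrow> 'a"
  have cx: "complexity X n = card (P n ` X)" for n
    unfolding complexity_def words_of_length P_def ..
  have fin: "finite (P n ` X)" for n
    by (rule finite_subset[OF _ finite_lists_length_eq[OF finite_alphabet, of n]])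
      (use letter_in in \<open>auto simp: P_def\<close>)
  have tlP: "tl (P (Suc n) y) = P n (shift y)" for y
    by (rule nth_equalityI) (auto simp: P_def nth_tl shift_def simp del: upt_Suc)
  have onto: "tl ` (P (Suc n) ` X) = P n ` X"
  proof (intro equalityI subsetI)
    fix w assume "w \<in> P n ` X"
    then obtain x where x: "x \<in> X" "w = P n x" by blast
    obtain y where "y \<in> X" "shift y = x" using shift_surj x(1) by blast
    then show "w \<in> tl ` (P (Suc n) ` X)" using x(2) tlP by (metis imageI)
  qed (auto simp: tlP intro: shift_in)
  \<comment> \<open>\<open>e\<close> picks one left extension of each word of length
    \<open>n\<close>, and \<open>e'\<close> a second one for each prefix of a point of
    \<open>S\<close>. Both are injective with disjoint ranges, so the sizes add up.\<close>
  define e where "e = inv_into (P (Suc n) ` X) tl"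
  have e: "e w \<in> P (Suc n) ` X" "tl (e w) = w" if "w \<in> P n ` X" for w
    using that unfolding e_def onto[symmetric] by (auto intro: inv_into_into f_inv_into_f)
  have "\<exists>u\<in>P (Suc n) ` X. tl u = P n x \<and> u \<noteq> e (P n x)" if xS: "x \<in> S" for x
  proof -
    obtain y z where yz: "y \<in> X" "z \<in> X" "y \<noteq> z" "shift y = x" "shift z = x"
      using subsetD[OF assms(1) xS] unfolding branching_def by blast
    then have "y 0 \<noteq> z 0" using eq_if_shift_eq by metis
    then have "hd (P (Suc n) y) \<noteq> hd (P (Suc n) z)" by (simp add: P_def upt_rec[of 0] del: upt_Suc)
    then show ?thesis using yz tlP by (metis imageI)
  qed
  then obtain e' where e': "\<And>x. x \<in> S \<Longrightarrow> e' x \<in> P (Suc n) ` X"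
    "\<And>x. x \<in> S \<Longrightarrow> tl (e' x) = P n x" "\<And>x. x \<in> S \<Longrightarrow> e' x \<noteq> e (P n x)"
    by metis
  have "inj_on e (P n ` X)" using e(2) by (metis inj_onI)
  moreover have "inj_on e' S"
  proof (rule inj_onI)
    fix x y assume xy: "x \<in> S" "y \<in> S" "e' x = e' y"
    then have "P n x = P n y" using e'(2) by metis
    then show "x = y" using dist[OF xy(1,2)] by (simp add: P_def)
  qed
  moreover have "e ` (P n ` X) \<inter> e' ` S = {}"
  proof (rule ccontr)
    assume "e ` (P n ` X) \<inter> e' ` S \<noteq> {}"
    then obtain w x where wx: "w \<in> P n ` X" "x \<in> S" "e w = e' x" by blast
    then have "w = P n x" using e(2) e'(2) by metis
    then show False using wx e'(3) by metis
  qed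
  ultimately have "card (e ` (P n ` X) \<union> e' ` S) = card (P n ` X) + card S"
    using fin assms(2) by (simp add: card_Un_disjoint card_image)
  moreover have "card (e ` (P n ` X) \<union> e' ` S) \<le> card (P (Suc n) ` X)"
    using e(1) e'(1) by (intro card_mono fin) auto
  ultimately show ?thesis by (simp add: cx)
qed

lemma finite_branching:
  assumes "sublinear_complexity X"
  shows "finite (branching X)"
proof (rule ccontr)
  assume inf: "infinite (branching X)"
  obtain a b where ab: "\<And>n. n \<ge> 1 \<Longrightarrow> real (complexity X n) \<le> a * real n + b"
    using assms by (auto simp: sublinear_complexity_def)
  \<comment> \<open>With \<open>K\<close> at least one above the slope \<open>a\<close>, the growth
    estimate yields \<open>k * (a + 1) \<le> a * (Suc m + k) + b\<close>, which fails once
    \<open>k\<close> exceeds \<open>a * Suc m + b\<close>.\<close>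
  define K where "K = nat \<lceil>a\<rceil> + 1"
  have K: "real K \<ge> a + 1" unfolding K_def by linarith
  obtain S where S: "S \<subseteq> branching X" "finite S" "card S = K"
    using inf infinite_arbitrarily_large by blast
  obtain m where m: "\<And>x y. x \<in> S \<Longrightarrow> y \<in> S \<Longrightarrow> \<forall>i<m. x i = y i \<Longrightarrow> x = y"
    using finite_set_prefix_distinct[OF S(2)] by blast
  have growth: "k * K \<le> complexity X (Suc m + k)" for k
  proof (induction k)
    case (Suc k)
    have "complexity X (Suc m + k) + card S \<le> complexity X (Suc (Suc m + k))"
      by (rule complexity_Suc[OF S(1,2)]) (rule m, auto)
    then show ?case using Suc S(3) by simp
  qed simp
  obtain k :: nat where k: "real k > a * real (Suc m) + b" using reals_Archimedean2 by blast
  have "real k * (a + 1) \<le> real k * real K" using K by (intro mult_left_mono) auto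
  also have "\<dots> \<le> real (complexity X (Suc m + k))" using growth[of k] by (metis of_nat_le_iff of_nat_mult)
  also have "\<dots> \<le> a * real (Suc m + k) + b" by (rule ab) simp
  finally show False using k by (simp add: algebra_simps)
qed

subsection \<open>Automorphisms of the one-sided shift\<close>

lemma Aut_funpow_shift:
  assumes "\<Phi> \<in> carrier (Aut A X)" "x \<in> X"
  shows "\<Phi> ((shift ^^ n) x) = (shift ^^ n) (\<Phi> x)"
  using assms by (induction n) (simp_all add: carrier_Aut funpow_shift_in)

lemma Aut_eqI:
  assumes P: "\<Phi> \<in> carrier (Aut A X)" "\<Psi> \<in> carrier (Aut A X)" and x: "x \<in> X" "\<Phi> x = \<Psi> x"
  shows "\<Phi> = \<Psi>"
proof (rule extensionalityI[of _ X])
  show "\<Phi> \<in> extensional X" "\<Psi> \<in> extensional X" using P by (auto simp: carrier_Aut Bij_def)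
  fix z assume "z \<in> X"
  then have "z \<in> subtopology (seq_top A) X closure_of {(shift ^^ n) x | n. True}"
    using minimal x(1) by (auto simp: minimal_one_sided_def)
  then show "\<Phi> z = \<Psi> z"
    by (rule forall_in_closure_of_eq[OF _ Hausdorff_seq_top])
      (use P x Aut_funpow_shift in \<open>auto simp: carrier_Aut\<close>)
qed

text \<open>An automorphism maps the fibre of the shift over \<open>b\<close> bijectively onto the
  fibre over the image of \<open>b\<close>.\<close>

lemma Aut_branch_points:
  assumes P: "\<Phi> \<in> carrier (Aut A X)" and b: "b \<in> branch_points X k"
  shows "\<Phi> b \<in> branch_points X k"
proof -
  have inj: "inj_on \<Phi> X" and im: "\<Phi> ` X = X"
    using P by (auto simp: carrier_Aut Bij_def bij_betw_def)
  have bX: "b \<in> X" "card {y \<in> X. shift y = b} = k" using b by (auto simp: branch_points_def)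
  have comm: "\<Phi> (shift y) = shift (\<Phi> y)" if "y \<in> X" for y using P that by (auto simp: carrier_Aut)
  have "{y \<in> X. shift y = \<Phi> b} = \<Phi> ` {y \<in> X. shift y = b}"
  proof (intro equalityI subsetI)
    fix y assume y: "y \<in> {y \<in> X. shift y = \<Phi> b}"
    then obtain u where u: "u \<in> X" "y = \<Phi> u" using im by (auto simp: image_iff set_eq_iff)
    have "\<Phi> (shift u) = \<Phi> b" using comm u y by simp
    then have "shift u = b" using inj_onD[OF inj] u(1) bX(1) shift_in by metis
    then show "y \<in> \<Phi> ` {y \<in> X. shift y = b}" using u by blast
  qed (use comm im in auto)
  then have "card {y \<in> X. shift y = \<Phi> b} = k"
    using bX(2) inj by (simp add: card_image inj_on_subset)
  then show ?thesis using im bX(1) by (auto simp: branch_points_def)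
qed

lemma counts_ok_branch_points:
  assumes "sublinear_complexity X"
  shows "counts_ok (branch_points X)"
proof -
  have fin: "finite (branch_points X k)" if "k \<ge> 2" for k
    using finite_subset[OF branch_points_sub[OF that] finite_branching[OF assms]] .
  obtain b where "b \<in> branching X" using branching_nonempty by blast
  then obtain k where "k \<ge> 2" "b \<in> branch_points X k" using branching_order by blast
  then show ?thesis using fin unfolding counts_ok_def
    by (metis Suc_le_eq One_nat_def card_gt_0_iff empty_iff)
qed

lemma card_Aut:
  assumes "sublinear_complexity X"
  shows "finite (carrier (Aut A X)) \<and> card (carrier (Aut A X)) \<le> min_count (branch_points X)"
proof -
  obtain k where k: "card (branch_points X k) = min_count (branch_points X)"
    "branch_points X k \<noteq> {}" "finite (branch_points X k)"
    using min_count_attained[OF counts_ok_branch_points[OF assms]] by metis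
  then obtain b where b: "b \<in> branch_points X k" by blast
  then have "b \<in> X" by (simp add: branch_points_def)
  then have "inj_on (\<lambda>\<Phi>. \<Phi> b) (carrier (Aut A X))" by (intro inj_onI Aut_eqI)
  moreover have "(\<lambda>\<Phi>. \<Phi> b) ` carrier (Aut A X) \<subseteq> branch_points X k"
    using Aut_branch_points[OF _ b] by (simp add: image_subset_iff)
  ultimately show ?thesis
    using card_inj_on_le[of _ "carrier (Aut A X)" "branch_points X k"]
      inj_on_finite[of _ "carrier (Aut A X)" "branch_points X k"] k(1,3) by simp
qed

end

subsection \<open>The two-sided version\<close>

text \<open>Here \<open>g\<close> factors through \<open>F\<close>. Later \<open>g\<close> sends an
  automorphism to its coset and \<open>F\<close> sends it to an asymptotic class, so cosets are
  counted without having to define a map on them.\<close>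

lemma card_image_le_if_factors:
  assumes "finite B" "F ` C \<subseteq> B" "\<And>a b. a \<in> C \<Longrightarrow> b \<in> C \<Longrightarrow> F a = F b \<Longrightarrow> g a = g b"
  shows "finite (g ` C) \<and> card (g ` C) \<le> card B"
proof -
  have "g a = (g \<circ> inv_into C F) (F a)" if "a \<in> C" for a
    using assms(3)[OF that, of "inv_into C F (F a)"] that
    by (simp add: inv_into_into f_inv_into_f)
  then have eq: "g ` C = (g \<circ> inv_into C F) ` (F ` C)" by (simp add: image_image)
  have fin: "finite (F ` C)" by (rule finite_subset[OF assms(2,1)])
  show ?thesis unfolding eq
    using card_image_le[OF fin, of "g \<circ> inv_into C F"] card_mono[OF assms(1,2)] fin by simp
qed

text \<open>The link between the two shifts: membership in the two-sided version, right
  asymptoticity and branching are all expressed through these one-sided sequences.\<close>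

definition tail :: "int \<Rightarrow> (int \<Rightarrow> 'a) \<Rightarrow> nat \<Rightarrow> 'a" where
  "tail i x = (\<lambda>n. x (i + int n))"

lemma tail_zshift: "tail i (zshift n x) = tail (i + n) x"
  by (simp add: tail_def zshift_def algebra_simps)

lemma shift_tail: "shift (tail i x) = tail (i + 1) x"
  by (simp add: tail_def shift_def algebra_simps)

lemma funpow_shift_tail: "(shift ^^ n) (tail i x) = tail (i + int n) x"
  by (simp add: tail_def funpow_shift algebra_simps)

lemma tail_eq_iff: "tail N x = tail N y \<longleftrightarrow> (\<forall>n\<ge>N. x n = y n)"
proof
  assume eq: "tail N x = tail N y"
  show "\<forall>n\<ge>N. x n = y n"
  proof (intro allI impI)
    fix n assume "N \<le> n"
    then show "x n = y n" using fun_cong[OF eq, of "nat (n - N)"] by (simp add: tail_def)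
  qed
qed (auto simp: tail_def)

lemma right_asymptotic_iff_tail: "right_asymptotic x y \<longleftrightarrow> (\<exists>N. tail N x = tail N y)"
  by (simp add: right_asymptotic_def tail_eq_iff)

lemma right_asymptotic_refl: "right_asymptotic x x"
  by (simp add: right_asymptotic_def)

lemma right_asymptotic_sym: "right_asymptotic x y \<Longrightarrow> right_asymptotic y x"
  unfolding right_asymptotic_def by metis

lemma right_asymptotic_trans:
  assumes "right_asymptotic x y" "right_asymptotic y z"
  shows "right_asymptotic x z"
proof -
  obtain M N where "\<forall>n\<ge>M. x n = y n" "\<forall>n\<ge>N. y n = z n"
    using assms by (auto simp: right_asymptotic_def)
  then have "\<forall>n\<ge>max M N. x n = z n" by simp
  then show ?thesis unfolding right_asymptotic_def by blast
qed

lemma right_asymptotic_zshift: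
  assumes "right_asymptotic x y"
  shows "right_asymptotic (zshift n x) (zshift n y)"
proof -
  obtain N where "tail N x = tail N y" using assms by (auto simp: right_asymptotic_iff_tail)
  then have "tail (N - n) (zshift n x) = tail (N - n) (zshift n y)" by (simp add: tail_zshift)
  then show ?thesis unfolding right_asymptotic_iff_tail by blast
qed

lemma zshift_zshift: "zshift m (zshift n x) = zshift (m + n) x"
  by (simp add: zshift_add)

lemma orbit_self: "x \<in> orbit x"
  unfolding orbit_def using zshift_zero by (metis (mono_tags, lifting) id_apply mem_Collect_eq)

lemma zshift_in_orbit: "zshift n x \<in> orbit x"
  by (auto simp: orbit_def)

lemma in_orbitE: "y \<in> orbit x \<Longrightarrow> (\<And>n. y = zshift n x \<Longrightarrow> thesis) \<Longrightarrow> thesis"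
  by (auto simp: orbit_def)

lemma orbit_eq:
  assumes "y \<in> orbit x"
  shows "orbit y = orbit x"
proof -
  obtain n where n: "y = zshift n x" using assms by (rule in_orbitE)
  then have "zshift m x = zshift (m - n) y" for m by (simp add: zshift_zshift)
  then show ?thesis unfolding orbit_def using n zshift_zshift by blast
qed

context infinite_minimal_shift
begin

abbreviation Xbar :: "(int \<Rightarrow> 'a) set" where
  "Xbar \<equiv> two_sided_version X"

abbreviation asym :: "((int \<Rightarrow> 'a) set \<times> (int \<Rightarrow> 'a) set) set" where
  "asym \<equiv> asymptotic_rel Xbar"

text \<open>The words of \<open>x\<close> read from position \<open>i\<close> are the prefixes of
  \<open>tail i x\<close>; closedness of \<open>X\<close> lets prefixes in the language stand for
  membership.\<close>

lemma in_Xbar_iff: "x \<in> Xbar \<longleftrightarrow> (\<forall>i. tail i x \<in> X)"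
proof
  assume x: "x \<in> Xbar"
  show "\<forall>i. tail i x \<in> X"
  proof
    fix i
    show "tail i x \<in> X"
    proof (rule in_X_if_prefixes)
      fix n
      have "word_at x i n \<in> language {x}" unfolding language_def by blast
      then have "word_at x i n \<in> language X" using x unfolding two_sided_version_def by blast
      then have "word_at x i n \<in> {w \<in> language X. length w = n}" by (simp add: word_at_def)
      then obtain y where "y \<in> X" "word_at x i n = map y [0..<n]"
        unfolding words_of_length by blast
      then show "\<exists>s\<in>X. \<forall>j<n. s j = tail i x j"
        by (intro bexI[of _ y]) (simp_all add: word_at_def tail_def)
    qed
  qed
next
  assume x: "\<forall>i. tail i x \<in> X"
  have "word_at x i n \<in> language X" for i n
  proof -
    have "word_at x i n = map (tail i x) [0..<n]" by (simp add: word_at_def tail_def)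
    then have "word_at x i n \<in> {w \<in> language X. length w = n}"
      unfolding words_of_length using x by blast
    then show ?thesis by simp
  qed
  then show "x \<in> Xbar" by (auto simp: two_sided_version_def language_def[of "{x}"])
qed

lemma tail_in: "x \<in> Xbar \<Longrightarrow> tail i x \<in> X"
  by (simp add: in_Xbar_iff)

lemma zshift_in: "x \<in> Xbar \<Longrightarrow> zshift n x \<in> Xbar"
  by (simp add: in_Xbar_iff tail_zshift)

lemma orbit_sub_Xbar: "x \<in> Xbar \<Longrightarrow> orbit x \<subseteq> Xbar"
  by (auto simp: orbit_def zshift_in)

lemma Xbar_sub: "Xbar \<subseteq> topspace (seq_top A)"
proof
  fix x assume "x \<in> Xbar"
  then have "x i \<in> A" for i using letter_in[OF tail_in, of x i 0] by (simp add: tail_def)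
  then show "x \<in> topspace (seq_top A)" by (simp add: topspace_seq_top)
qed

lemma closed_Xbar: "closedin (seq_top A) Xbar"
  unfolding closedin_seq_top_iff
proof (intro conjI ballI impI)
  fix z assume z: "\<forall>F. finite F \<longrightarrow> (\<exists>s\<in>Xbar. \<forall>i\<in>F. s i = z i)"
  have "tail i z \<in> X" for i
  proof (rule in_X_if_prefixes)
    fix n
    obtain s where s: "s \<in> Xbar" "\<forall>j\<in>{i..i + int n}. s j = z j"
      using z by (metis finite_atLeastAtMost_int)
    then show "\<exists>s\<in>X. \<forall>j<n. s j = tail i z j"
      by (intro bexI[of _ "tail i s"]) (simp_all add: tail_in, simp add: tail_def)
  qed
  then show "z \<in> Xbar" by (simp add: in_Xbar_iff)
qed (rule Xbar_sub)

lemma shift_in_Xbar: "shift ` Xbar \<subseteq> Xbar"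
  using zshift_in[of _ 1] by (auto simp: zshift_one)

lemma group_Aut_Xbar: "group (Aut A Xbar)"
  by (rule group_Aut[OF finite_alphabet closed_Xbar shift_in_Xbar])

text \<open>Both tails are shifts of the one starting at \<open>min i j\<close>, so equality would
  contradict aperiodicity.\<close>

lemma tail_inj:
  assumes "x \<in> Xbar" "tail i x = tail j x"
  shows "i = j"
proof -
  define k where "k = min i j"
  have "(shift ^^ nat (i - k)) (tail k x) = (shift ^^ nat (j - k)) (tail k x)"
    using assms(2) by (simp add: funpow_shift_tail k_def)
  from aperiodic[OF tail_in[OF assms(1)] this] show ?thesis by (simp add: k_def)
qed

text \<open>Choose preimages under the shift again and again, and read off the letter that each
  choice prepends.\<close>

lemma extend_left:
  assumes "y \<in> X"
  obtains x where "x \<in> Xbar" "tail 0 x = y"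
proof -
  define g where "g = inv_into X shift"
  have "z \<in> shift ` X" if "z \<in> X" for z
    by (rule shift_surj[OF that]) blast
  then have g: "g z \<in> X" "shift (g z) = z" if "z \<in> X" for z
    using that by (simp_all add: g_def inv_into_into f_inv_into_f)
  have gn: "(g ^^ n) y \<in> X" for n by (induction n) (simp_all add: g assms)
  have "(g ^^ Suc n) y (Suc i) = (g ^^ n) y i" for n i
    using fun_cong[OF g(2)[OF gn[of n]], of i] by (simp add: shift_def)
  \<comment> \<open>Coherence of the choices: dropping \<open>m\<close> letters from the preimage of
    level \<open>m + n\<close> gives the one of level \<open>n\<close>. Hence the letters collected
    in \<open>x\<close> fit together and level \<open>n\<close> is the tail at
    \<open>-n\<close>.\<close>
  then have sg: "(g ^^ (m + n)) y (i + m) = (g ^^ n) y i" for m n i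
    by (induction m) (simp_all del: funpow.simps)
  define x where "x i = (if i \<ge> 0 then y (nat i) else (g ^^ nat (-i)) y 0)" for i
  have tail_neg: "tail (- int n) x = (g ^^ n) y" for n
  proof
    fix m
    show "tail (- int n) x m = (g ^^ n) y m"
    proof (cases "n \<le> m")
      case True
      then show ?thesis using sg[of n 0 "m - n"] by (simp add: tail_def x_def nat_diff_distrib)
    next
      case False
      then show ?thesis using sg[of m "n - m" 0] by (simp add: tail_def x_def nat_diff_distrib)
    qed
  qed
  have "tail i x \<in> X" for i
  proof (cases "i \<ge> 0")
    case True
    then have "tail i x = (shift ^^ nat i) (tail 0 x)" by (simp add: funpow_shift_tail)
    then show ?thesis using tail_neg[of 0] assms by (simp add: funpow_shift_in)
  next
    case False
    then show ?thesis using tail_neg[of "nat (-i)"] gn by simp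
  qed
  then have "x \<in> Xbar" by (simp add: in_Xbar_iff)
  then show ?thesis using that tail_neg[of 0] by simp
qed

text \<open>The start \<open>N\<close> is arbitrary because right asymptotic points agree only from
  some unknown coordinate on.\<close>

lemma dense_forward_orbit:
  assumes x: "x \<in> Xbar" and z: "z \<in> Xbar"
  shows "z \<in> subtopology (seq_top A) Xbar closure_of {zshift j x | j. j \<ge> N}"
proof (subst in_closure_seq_top[OF _ Xbar_sub], goal_cases)
  case 1
  then show ?case using zshift_in[OF x] by blast
next
  case 2
  show ?case
  proof (intro conjI allI impI z)
    fix F :: "int set" assume F: "finite F"
    \<comment> \<open>\<open>F\<close> lies in the window from \<open>-r\<close> to
      \<open>r\<close>, which has \<open>2 * r + 1\<close> letters. If it recurs in \<open>x\<close>
      at \<open>N + m\<close>, then its centre is at \<open>N + m + r\<close>, hence the shift by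
      that amount. Inserting 0 keeps \<open>r\<close> defined and nonnegative for empty
      \<open>F\<close>.\<close>
    define r where "r = Max (insert 0 (abs ` F))"
    have r: "\<bar>i\<bar> \<le> r" if "i \<in> F" for i using that F by (simp add: r_def)
    have r0: "r \<ge> 0" using F by (simp add: r_def)
    obtain m where m: "\<forall>i < nat (2 * r + 1). tail N x (m + i) = tail (-r) z i"
      using recurrent[OF tail_in[OF x] tail_in[OF z]] by blast
    have "zshift (N + int m + r) x i = z i" if "i \<in> F" for i
    proof -
      have "nat (i + r) < nat (2 * r + 1)" using r[OF that] by linarith
      from m[rule_format, OF this] show ?thesis
        using r[OF that] by (simp add: tail_def zshift_def add_ac abs_le_iff)
    qed
    moreover have "N + int m + r \<ge> N" using r0 by simp
    ultimately show "\<exists>s\<in>{zshift j x | j. j \<ge> N}. \<forall>i\<in>F. s i = z i" by blast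
  qed
qed

section \<open>Automorphisms of the two-sided shift\<close>

lemma Aut_props:
  assumes "\<Phi> \<in> carrier (Aut A Xbar)"
  shows "inj_on \<Phi> Xbar" "\<Phi> ` Xbar = Xbar" "\<And>x. x \<in> Xbar \<Longrightarrow> \<Phi> x \<in> Xbar" "\<Phi> \<in> extensional Xbar"
    "\<And>x. x \<in> Xbar \<Longrightarrow> \<Phi> (shift x) = shift (\<Phi> x)"
  using assms by (auto simp: carrier_Aut Bij_def bij_betw_def)

lemma Aut_zshift:
  assumes P: "\<Phi> \<in> carrier (Aut A Xbar)" and x: "x \<in> Xbar"
  shows "\<Phi> (zshift n x) = zshift n (\<Phi> x)"
proof -
  have nonneg: "\<Phi> (zshift (int k) x) = zshift (int k) (\<Phi> x)" if "x \<in> Xbar" for k x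
  proof (induction k)
    case 0
    then show ?case by (simp add: zshift_zero)
  next
    case (Suc k)
    have "\<Phi> (zshift (int (Suc k)) x) = \<Phi> (shift (zshift (int k) x))"
      by (simp add: zshift_zshift flip: zshift_one)
    also have "\<dots> = shift (zshift (int k) (\<Phi> x))"
      using Aut_props(5)[OF P] zshift_in[OF that] Suc by simp
    finally show ?case by (simp add: zshift_zshift flip: zshift_one)
  qed
  show ?thesis
  proof (cases "n \<ge> 0")
    case True
    then show ?thesis using nonneg[OF x, of "nat n"] by simp
  next
    case False
    \<comment> \<open>A negative power is handled by applying the nonnegative case to the point
      \<open>zshift n x\<close> and exponent \<open>-n\<close>, then undoing the shift.\<close>
    have "zshift (-n) (\<Phi> (zshift n x)) = \<Phi> (zshift (-n) (zshift n x))"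
      using nonneg[OF zshift_in[OF x], of "nat (-n)" n] False by simp
    also have "\<dots> = \<Phi> x" by (simp add: zshift_zshift zshift_zero)
    finally have "zshift n (zshift (-n) (\<Phi> (zshift n x))) = zshift n (\<Phi> x)" by simp
    then show ?thesis by (simp add: zshift_zshift zshift_zero)
  qed
qed

lemma continuous_map_Aut_coord:
  assumes "\<Phi> \<in> carrier (Aut A Xbar)"
  shows "continuous_map (subtopology (seq_top A) Xbar) (discrete_topology A) (\<lambda>x. \<Phi> x i)"
proof -
  have "continuous_map (subtopology (seq_top A) Xbar) (discrete_topology A) ((\<lambda>x. x i) \<circ> \<Phi>)"
    using assms by (intro continuous_map_compose[OF _ continuous_map_coord[of A Xbar]]) (simp add: carrier_Aut)
  then show ?thesis by (simp add: o_def)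
qed

lemma Aut_eq_if_right_asymptotic:
  assumes P: "\<Phi> \<in> carrier (Aut A Xbar)" "\<Psi> \<in> carrier (Aut A Xbar)"
    and x: "x \<in> Xbar" "right_asymptotic (\<Phi> x) (\<Psi> x)"
  shows "\<Phi> = \<Psi>"
proof (rule extensionalityI[of _ Xbar])
  show "\<Phi> \<in> extensional Xbar" "\<Psi> \<in> extensional Xbar" using Aut_props(4) P by auto
  obtain N where N: "\<And>n. n \<ge> N \<Longrightarrow> \<Phi> x n = \<Psi> x n"
    using x(2) by (auto simp: right_asymptotic_def)
  \<comment> \<open>Agreement of the images of \<open>x\<close> at a coordinate
    \<open>j \<ge> N\<close> is agreement at coordinate 0 of the images of
    \<open>zshift j x\<close>. Coordinate 0 is continuous, so density extends this to all points;
    the other coordinates follow by shifting.\<close>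
  have at0: "\<Phi> z 0 = \<Psi> z 0" if "z \<in> Xbar" for z
  proof (rule forall_in_closure_of_eq[OF dense_forward_orbit[OF x(1) that, of N]])
    show "Hausdorff_space (discrete_topology A)" by simp
    fix s assume "s \<in> {zshift j x | j. j \<ge> N}"
    then obtain j where "s = zshift j x" "j \<ge> N" by blast
    then show "\<Phi> s 0 = \<Psi> s 0" using N by (simp add: Aut_zshift[OF _ x(1)] P) (simp add: zshift_def)
  qed (rule continuous_map_Aut_coord[OF P(1)] continuous_map_Aut_coord[OF P(2)])+
  fix z assume z: "z \<in> Xbar"
  show "\<Phi> z = \<Psi> z"
  proof
    fix i
    have "zshift i (\<Phi> z) 0 = zshift i (\<Psi> z) 0"
      using at0[OF zshift_in[OF z, of i]] by (simp add: Aut_zshift[OF _ z] P)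
    then show "\<Phi> z i = \<Psi> z i" by (simp add: zshift_def)
  qed
qed

text \<open>Coordinate \<open>j\<close> of the image depends only on finitely many coordinates, all
  at or to the right of \<open>j + r\<close>; so agreement from \<open>N\<close> on becomes
  agreement from \<open>N - r\<close> on.\<close>

lemma Aut_right_asymptotic:
  assumes P: "\<Phi> \<in> carrier (Aut A Xbar)" and x: "x \<in> Xbar" and y: "y \<in> Xbar"
    and xy: "right_asymptotic x y"
  shows "right_asymptotic (\<Phi> x) (\<Phi> y)"
proof -
  obtain F where F: "finite F"
    "\<And>u v. u \<in> Xbar \<Longrightarrow> v \<in> Xbar \<Longrightarrow> \<forall>i\<in>F. u i = v i \<Longrightarrow> \<Phi> u 0 = \<Phi> v 0"
    using continuous_map_finite_window[OF finite_alphabet closed_Xbar continuous_map_Aut_coord[OF P, of 0]]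
    by blast
  obtain r where r: "\<And>i. i \<in> F \<Longrightarrow> r \<le> i"
    using bdd_below_finite[OF F(1)] by (auto simp: bdd_below_def)
  obtain N where N: "\<And>n. n \<ge> N \<Longrightarrow> x n = y n" using xy by (auto simp: right_asymptotic_def)
  have "\<Phi> x j = \<Phi> y j" if "j \<ge> N - r" for j
  proof -
    have "\<Phi> (zshift j x) 0 = \<Phi> (zshift j y) 0"
    proof (rule F(2)[OF zshift_in[OF x] zshift_in[OF y]], rule ballI)
      fix i assume "i \<in> F"
      then have "i + j \<ge> N" using r[of i] that by linarith
      then show "zshift j x i = zshift j y i" using N by (simp add: zshift_def)
    qed
    then show ?thesis by (simp add: Aut_zshift P x y) (simp add: zshift_def)
  qed
  then show ?thesis unfolding right_asymptotic_def by blast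
qed

lemma Aut_orbit:
  assumes "\<Phi> \<in> carrier (Aut A Xbar)" "x \<in> Xbar"
  shows "\<Phi> ` orbit x = orbit (\<Phi> x)"
proof -
  have "\<Phi> ` orbit x = {\<Phi> (zshift n x) | n. True}" by (auto simp: orbit_def)
  then show ?thesis using Aut_zshift[OF assms] by (simp add: orbit_def)
qed

section \<open>Asymptotic orbits: equivalence classes, finiteness and existence\<close>

lemma asymptotic_orbit_sub: "P \<in> asymptotic_orbits Xbar \<Longrightarrow> P \<subseteq> Xbar"
  using orbit_sub_Xbar by (auto simp: asymptotic_orbits_def)

lemma asymptotic_orbitE:
  assumes "P \<in> asymptotic_orbits Xbar"
  obtains x y where "x \<in> Xbar" "P = orbit x" "y \<in> Xbar" "orbit x \<inter> orbit y = {}" "right_asymptotic x y"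
proof -
  obtain u v where uv: "P = orbit u" "u \<in> Xbar" "v \<in> Xbar" "orbit u \<inter> orbit v = {}"
    "orbits_right_asymptotic (orbit u) (orbit v)"
    using assms by (auto simp: asymptotic_orbits_def)
  then obtain x y where xy: "x \<in> orbit u" "y \<in> orbit v" "right_asymptotic x y"
    by (auto simp: orbits_right_asymptotic_def)
  show ?thesis
    using uv xy orbit_eq[OF xy(1)] orbit_eq[OF xy(2)] orbit_sub_Xbar[OF uv(2)] orbit_sub_Xbar[OF uv(3)]
    by (intro that[of x y]) auto
qed

lemma asymptotic_orbitI:
  assumes "x \<in> Xbar" "y \<in> Xbar" "orbit x \<inter> orbit y = {}" "right_asymptotic x y"
  shows "orbit x \<in> asymptotic_orbits Xbar"
proof -
  have "orbits_right_asymptotic (orbit x) (orbit y)"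
    unfolding orbits_right_asymptotic_def using assms(4) orbit_self by blast
  then show ?thesis unfolding asymptotic_orbits_def using assms by blast
qed

lemma orbits_right_asymptotic_iff:
  "orbits_right_asymptotic (orbit x) (orbit y) \<longleftrightarrow> (\<exists>n. right_asymptotic x (zshift n y))"
proof
  assume "orbits_right_asymptotic (orbit x) (orbit y)"
  then obtain m n where "right_asymptotic (zshift m x) (zshift n y)"
    by (auto simp: orbits_right_asymptotic_def orbit_def)
  from right_asymptotic_zshift[OF this, of "-m"]
  have "right_asymptotic x (zshift (n - m) y)" by (simp add: zshift_zshift zshift_zero)
  then show "\<exists>n. right_asymptotic x (zshift n y)" by blast
next
  assume "\<exists>n. right_asymptotic x (zshift n y)"
  then show "orbits_right_asymptotic (orbit x) (orbit y)"
    unfolding orbits_right_asymptotic_def using orbit_self zshift_in_orbit by blast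
qed

lemma equiv_asymptotic: "equiv (asymptotic_orbits Xbar) asym"
proof (rule equivI)
  show "asym \<subseteq> asymptotic_orbits Xbar \<times> asymptotic_orbits Xbar"
    by (auto simp: asymptotic_rel_def)
  show "refl_on (asymptotic_orbits Xbar) asym"
  proof (rule refl_onI)
    fix P assume P: "P \<in> asymptotic_orbits Xbar"
    then obtain x where "P = orbit x" by (rule asymptotic_orbitE)
    then have "orbits_right_asymptotic P P"
      unfolding orbits_right_asymptotic_def using orbit_self right_asymptotic_refl by blast
    then show "(P, P) \<in> asym" using P by (simp add: asymptotic_rel_def)
  qed
  show "sym asym"
    unfolding sym_def asymptotic_rel_def orbits_right_asymptotic_def
    using right_asymptotic_sym by blast
  show "trans asym"
  proof (rule transI)
    fix P Q R assume PQ: "(P, Q) \<in> asym" and QR: "(Q, R) \<in> asym"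
    then have mem: "P \<in> asymptotic_orbits Xbar" "Q \<in> asymptotic_orbits Xbar" "R \<in> asymptotic_orbits Xbar"
      by (simp_all add: asymptotic_rel_def)
    obtain x where x: "P = orbit x" using mem(1) by (rule asymptotic_orbitE)
    obtain y where y: "Q = orbit y" using mem(2) by (rule asymptotic_orbitE)
    obtain z where z: "R = orbit z" using mem(3) by (rule asymptotic_orbitE)
    obtain m n where "right_asymptotic x (zshift m y)" "right_asymptotic y (zshift n z)"
      using PQ QR by (auto simp: asymptotic_rel_def x y z orbits_right_asymptotic_iff)
    then have "right_asymptotic x (zshift (m + n) z)"
      using right_asymptotic_trans right_asymptotic_zshift zshift_zshift by metis
    then show "(P, R) \<in> asym"
      using mem by (auto simp: asymptotic_rel_def x z orbits_right_asymptotic_iff)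
  qed
qed

lemma Aut_asymptotic_rel:
  assumes P: "\<Phi> \<in> carrier (Aut A Xbar)" and PQ: "(P, Q) \<in> asym"
  shows "(\<Phi> ` P, \<Phi> ` Q) \<in> asym"
proof -
  have img: "\<Phi> ` R \<in> asymptotic_orbits Xbar" if "R \<in> asymptotic_orbits Xbar" for R
    using that
  proof (rule asymptotic_orbitE)
    fix x y assume xy: "x \<in> Xbar" "R = orbit x" "y \<in> Xbar" "orbit x \<inter> orbit y = {}" "right_asymptotic x y"
    have "orbit (\<Phi> x) \<inter> orbit (\<Phi> y) = \<Phi> ` (orbit x \<inter> orbit y)"
      using inj_on_image_Int[OF Aut_props(1)[OF P] orbit_sub_Xbar[OF xy(1)] orbit_sub_Xbar[OF xy(3)]]
      by (simp add: Aut_orbit[OF P] xy)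
    then have "orbit (\<Phi> x) \<inter> orbit (\<Phi> y) = {}" using xy(4) by simp
    then show ?thesis
      using asymptotic_orbitI[OF _ _ _ Aut_right_asymptotic[OF P xy(1,3,5)]] Aut_props(3)[OF P] xy(1-3)
      by (simp add: Aut_orbit[OF P])
  qed
  have mem: "P \<in> asymptotic_orbits Xbar" "Q \<in> asymptotic_orbits Xbar" "orbits_right_asymptotic P Q"
    using PQ by (simp_all add: asymptotic_rel_def)
  then obtain x y where "x \<in> P" "y \<in> Q" "right_asymptotic x y"
    by (auto simp: orbits_right_asymptotic_def)
  then have "orbits_right_asymptotic (\<Phi> ` P) (\<Phi> ` Q)"
    unfolding orbits_right_asymptotic_def
    using Aut_right_asymptotic[OF P] asymptotic_orbit_sub[OF mem(1)] asymptotic_orbit_sub[OF mem(2)] by blast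
  then show ?thesis using img mem by (simp add: asymptotic_rel_def)
qed

text \<open>Taking images under the automorphism is a bijection between the two classes, with images
  under its inverse going back.\<close>

lemma Aut_class_card:
  assumes P: "\<Phi> \<in> carrier (Aut A Xbar)" and S: "P \<in> asymptotic_orbits Xbar"
  shows "card (asym `` {\<Phi> ` P}) = card (asym `` {P})"
proof -
  interpret group "Aut A Xbar" by (rule group_Aut_Xbar)
  define \<Psi> where "\<Psi> = inv\<^bsub>Aut A Xbar\<^esub> \<Phi>"
  have Psi: "\<Psi> \<in> carrier (Aut A Xbar)" using P by (simp add: \<Psi>_def)
  have "compose Xbar \<Psi> \<Phi> = restrict id Xbar" "compose Xbar \<Phi> \<Psi> = restrict id Xbar"
    using l_inv[OF P] r_inv[OF P] P Psi by (simp_all add: mult_Aut one_Aut flip: \<Psi>_def)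
  then have cancel: "\<Psi> (\<Phi> x) = x" "\<Phi> (\<Psi> x) = x" if "x \<in> Xbar" for x
    using that by (metis compose_eq id_apply restrict_apply)+
  have cancel_image: "\<Psi> ` \<Phi> ` R = R" "\<Phi> ` \<Psi> ` R = R" if "R \<subseteq> Xbar" for R
    using cancel subsetD[OF that] by (simp_all add: image_image)
  have sub: "Q \<subseteq> Xbar" if "(R, Q) \<in> asym" for R Q
    using that asymptotic_orbit_sub by (simp add: asymptotic_rel_def)
  have "asym `` {\<Phi> ` P} = (`) \<Phi> ` (asym `` {P})"
  proof (intro equalityI subsetI)
    fix Q assume "Q \<in> asym `` {\<Phi> ` P}"
    then have Q: "(\<Phi> ` P, Q) \<in> asym" by simp
    then have "(P, \<Psi> ` Q) \<in> asym"
      using Aut_asymptotic_rel[OF Psi Q] cancel_image(1)[OF asymptotic_orbit_sub[OF S]] by simp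
    then show "Q \<in> (`) \<Phi> ` (asym `` {P})" using cancel_image(2)[OF sub[OF Q]] by (metis ImageI imageI singletonI)
  qed (use Aut_asymptotic_rel[OF P] in auto)
  moreover have "inj_on ((`) \<Phi>) (asym `` {P})"
    by (rule inj_onI) (use cancel_image(1) sub in \<open>metis Image_singleton_iff\<close>)
  ultimately show ?thesis by (simp add: card_image)
qed

text \<open>The last disagreement with an asymptotic partner produces a branching tail. Distinct
  positions have distinct tails, so finitely many branching points leave finitely many such
  positions, and a leftmost one exists. It gives a normalized representative of the orbit.\<close>

lemma leftmost_branching:
  assumes fin: "finite (branching X)" and P: "P \<in> asymptotic_orbits Xbar"
  shows "\<exists>x\<in>Xbar. P = orbit x \<and> tail 1 x \<in> branching X \<and> (\<forall>i\<le>0. tail i x \<notin> branching X)"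
  using P
proof (rule asymptotic_orbitE)
  fix x y assume xy: "x \<in> Xbar" "P = orbit x" "y \<in> Xbar" "orbit x \<inter> orbit y = {}" "right_asymptotic x y"
  have "x \<noteq> y" using xy(4) orbit_self by blast
  then obtain j where j: "x j \<noteq> y j" by blast
  obtain N where N: "\<And>n. n \<ge> N \<Longrightarrow> x n = y n" using xy(5) by (auto simp: right_asymptotic_def)
  \<comment> \<open>The lower bound \<open>j\<close>, a known disagreement, makes the set finite and
    nonempty, so that it has a maximum \<open>m\<close>; beyond \<open>m\<close> the two points
    agree.\<close>
  have "finite {n. j \<le> n \<and> n \<le> N \<and> x n \<noteq> y n}" by (rule finite_subset[of _ "{j..N}"]) auto
  moreover have "j \<in> {n. j \<le> n \<and> n \<le> N \<and> x n \<noteq> y n}" using j N[of j] by force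
  ultimately obtain m where m: "m \<in> {n. j \<le> n \<and> n \<le> N \<and> x n \<noteq> y n}"
    "\<And>n. n \<in> {n. j \<le> n \<and> n \<le> N \<and> x n \<noteq> y n} \<Longrightarrow> n \<le> m"
    by (metis (no_types, lifting) Max_ge Max_in empty_iff)
  have eq: "x n = y n" if "n > m" for n
    using m(2)[of n] m(1) that N[of n] by (cases "n \<le> N") auto
  have "tail (m + 1) x = tail (m + 1) y" using eq by (simp add: tail_eq_iff)
  moreover have "tail m x \<noteq> tail m y" using m(1) by (auto simp: tail_eq_iff)
  ultimately have "tail (m + 1) x \<in> branching X"
    unfolding branching_def using tail_in[OF xy(1)] tail_in[OF xy(3)] shift_tail
    by (metis (mono_tags, lifting) mem_Collect_eq)
  then have ne: "m + 1 \<in> {i. tail i x \<in> branching X}" by simp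
  have "finite {i. tail i x \<in> branching X}"
    by (rule finite_imageD[of "\<lambda>i. tail i x"], rule finite_subset[OF _ fin])
      (auto intro!: inj_onI tail_inj[OF xy(1)])
  with ne obtain k where k: "tail k x \<in> branching X" "\<And>i. tail i x \<in> branching X \<Longrightarrow> k \<le> i"
    by (metis Min_in Min_le empty_iff mem_Collect_eq)
  \<comment> \<open>The leftmost branching tail is moved to position 1, so no tail at a position up
    to 0 branches and \<open>tail 0 u\<close> determines \<open>u\<close> by
    \<open>eq_if_no_branching\<close>.\<close>
  define u where "u = zshift (k - 1) x"
  have "u \<in> Xbar" "P = orbit u"
    using zshift_in[OF xy(1)] orbit_eq[OF zshift_in_orbit, of "k - 1" x] xy(2) by (simp_all add: u_def)
  moreover have "tail 1 u \<in> branching X" using k(1) by (simp add: u_def tail_zshift)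
  moreover have "tail i u \<notin> branching X" if "i \<le> 0" for i
    using k(2)[of "i + (k - 1)"] that by (auto simp: u_def tail_zshift)
  ultimately show ?thesis by blast
qed

text \<open>A tail that is not branching has only one preimage, so agreement spreads to the left one
  letter at a time.\<close>

lemma eq_if_no_branching:
  assumes x: "x \<in> Xbar" "\<And>i. i \<le> 0 \<Longrightarrow> tail i x \<notin> branching X"
    and y: "y \<in> Xbar" "tail 0 x = tail 0 y"
  shows "x = y"
proof -
  have *: "tail (- int n) x = tail (- int n) y" for n
  proof (induction n)
    case (Suc n)
    define i where "i = - int (Suc n)"
    have i: "i + 1 = - int n" by (simp add: i_def)
    have "shift (tail i x) = tail (- int n) x" "shift (tail i y) = tail (- int n) x"
      using Suc by (simp_all add: shift_tail i)
    moreover have "tail (- int n) x \<notin> branching X" by (rule x(2)) simp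
    moreover have "tail i x \<in> X" "tail i y \<in> X" "tail (- int n) x \<in> X" using tail_in x(1) y(1) by auto
    ultimately show ?case unfolding branching_def i_def[symmetric] by blast
  qed (use y(2) in simp)
  show ?thesis
  proof
    fix j
    show "x j = y j"
      using *[of "nat \<bar>j\<bar>"] unfolding tail_eq_iff by simp
  qed
qed

text \<open>
  Each asymptotic orbit is coded by its one-sided tail starting just before the leftmost branching
  tail; there are finitely many such tails, since they are preimages of branching points.
\<close>

lemma finite_asymptotic_orbits:
  assumes "finite (branching X)"
  shows "finite (asymptotic_orbits Xbar)"
proof -
  obtain u where u: "\<And>P. P \<in> asymptotic_orbits Xbar \<Longrightarrow> u P \<in> Xbar \<and> P = orbit (u P) \<and>
      tail 1 (u P) \<in> branching X \<and> (\<forall>i\<le>0. tail i (u P) \<notin> branching X)"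
    using leftmost_branching[OF assms] by metis
  show ?thesis
  proof (rule finite_imageD[of "\<lambda>P. tail 0 (u P)"])
    have "(\<lambda>P. tail 0 (u P)) ` asymptotic_orbits Xbar \<subseteq> (\<Union>b\<in>branching X. {y \<in> X. shift y = b})"
      using u tail_in by (auto simp: shift_tail)
    then show "finite ((\<lambda>P. tail 0 (u P)) ` asymptotic_orbits Xbar)"
      by (rule finite_subset) (use assms finite_preimages in simp)
    show "inj_on (\<lambda>P. tail 0 (u P)) (asymptotic_orbits Xbar)"
    proof (rule inj_onI)
      fix P Q assume PQ: "P \<in> asymptotic_orbits Xbar" "Q \<in> asymptotic_orbits Xbar"
        and "tail 0 (u P) = tail 0 (u Q)"
      then have "u P = u Q" using u[OF PQ(1)] u[OF PQ(2)] by (intro eq_if_no_branching) auto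
      then show "P = Q" using u[OF PQ(1)] u[OF PQ(2)] by simp
    qed
  qed
qed

text \<open>Two preimages of a branching point, extended to the left, have the same tail at 1. If
  one extension were a shift of the other, aperiodicity would make the shift trivial and the
  preimages equal.\<close>

lemma asymptotic_orbits_nonempty: "asymptotic_orbits Xbar \<noteq> {}"
proof -
  obtain b y z where b: "y \<in> X" "z \<in> X" "y \<noteq> z" "shift y = b" "shift z = b"
    using branching_nonempty by (auto simp: branching_def)
  obtain u where u: "u \<in> Xbar" "tail 0 u = y" using extend_left[OF b(1)] by blast
  obtain v where v: "v \<in> Xbar" "tail 0 v = z" using extend_left[OF b(2)] by blast
  have tl: "tail 1 u = b" "tail 1 v = b" using u(2) v(2) b shift_tail[of 0 u] shift_tail[of 0 v] by simp_all
  have "orbit u \<inter> orbit v = {}"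
  proof (rule ccontr)
    assume "orbit u \<inter> orbit v \<noteq> {}"
    then obtain w where "w \<in> orbit u" "w \<in> orbit v" by blast
    then have "u \<in> orbit v" using orbit_eq orbit_self by metis
    then obtain p where p: "u = zshift p v" by (rule in_orbitE)
    then have "tail (1 + p) v = tail 1 v" using tl by (simp add: tail_zshift)
    then have "1 + p = 1" using tail_inj[OF v(1)] by blast
    then have "u = v" using p by (simp add: zshift_zero)
    then show False using u(2) v(2) b(3) by simp
  qed
  moreover have "right_asymptotic u v" using tl right_asymptotic_iff_tail by metis
  ultimately have "orbit u \<in> asymptotic_orbits Xbar" using asymptotic_orbitI u(1) v(1) by blast
  then show ?thesis by blast
qed

text \<open>Finiteness matters as well as the second orbit, since \<open>card\<close> of an infinite
  class would be 0.\<close>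

lemma class_card_ge_2:
  assumes fin: "finite (branching X)" and P: "P \<in> asymptotic_orbits Xbar"
  shows "card (asym `` {P}) \<ge> 2"
  using P
proof (rule asymptotic_orbitE)
  fix x y assume xy: "x \<in> Xbar" "P = orbit x" "y \<in> Xbar" "orbit x \<inter> orbit y = {}" "right_asymptotic x y"
  have Q: "orbit y \<in> asymptotic_orbits Xbar"
    using xy right_asymptotic_sym by (intro asymptotic_orbitI[of y x]) (auto simp: Int_commute)
  have "orbits_right_asymptotic P (orbit y)"
    unfolding orbits_right_asymptotic_def using xy(2,5) orbit_self by blast
  then have "(P, orbit y) \<in> asym" using P Q by (simp add: asymptotic_rel_def)
  moreover have "(P, P) \<in> asym" using equiv_asymptotic P by (simp add: equiv_def refl_on_def)
  moreover have "P \<noteq> orbit y" using xy(2,4) orbit_self by blast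
  moreover have "finite (asym `` {P})"
    by (rule finite_subset[OF _ finite_asymptotic_orbits[OF fin]]) (auto simp: asymptotic_rel_def)
  ultimately have "card {P, orbit y} \<le> card (asym `` {P})" by (intro card_mono) auto
  then show ?thesis using \<open>P \<noteq> orbit y\<close> by simp
qed

lemma counts_ok_asymptotic_classes:
  assumes fin: "finite (branching X)"
  shows "counts_ok (asymptotic_classes Xbar)"
proof -
  have "finite (asymptotic_orbits Xbar // asym)"
    by (rule finite_quotient[OF finite_asymptotic_orbits[OF fin]]) (auto simp: asymptotic_rel_def)
  then have f: "finite (asymptotic_classes Xbar k)" for k
    unfolding asymptotic_classes_def by simp
  obtain P where P: "P \<in> asymptotic_orbits Xbar" using asymptotic_orbits_nonempty by blast
  define k where "k = card (asym `` {P})"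
  have "asym `` {P} \<in> asymptotic_classes Xbar k"
    using P by (simp add: asymptotic_classes_def k_def quotientI)
  then have "card (asymptotic_classes Xbar k) \<ge> 1"
    using f[of k] by (metis Suc_le_eq One_nat_def card_gt_0_iff empty_iff)
  moreover have "k \<ge> 2" unfolding k_def by (rule class_card_ge_2[OF fin P])
  ultimately show ?thesis using f unfolding counts_ok_def by blast
qed

section \<open>The quotient by the powers of the shift\<close>

lemma zshift_in_Aut: "restrict (zshift n) Xbar \<in> carrier (Aut A Xbar)"
proof -
  let ?T = "subtopology (seq_top A) Xbar"
  have "bij_betw (zshift n) Xbar Xbar"
    by (rule bij_betw_byWitness[of _ "zshift (-n)"]) (auto simp: zshift_zshift zshift_zero zshift_in)
  then have "restrict (zshift n) Xbar \<in> Bij Xbar"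
    by (simp add: Bij_def cong: bij_betw_cong)
  moreover have "continuous_map ?T ?T (restrict (zshift n) Xbar)"
  proof -
    have "continuous_map ?T (seq_top A) (zshift n)"
      unfolding seq_top_def[of A, where 'i = int] continuous_map_componentwise_UNIV
      using continuous_map_coord[of A Xbar, unfolded seq_top_def] by (simp add: zshift_def)
    then have "continuous_map ?T ?T (zshift n)"
      using zshift_in by (auto simp: continuous_map_in_subtopology)
    then show ?thesis by (rule continuous_map_eq) simp
  qed
  moreover have "zshift n (shift x) = shift (zshift n x)" for x :: "int \<Rightarrow> 'a"
    by (simp add: zshift_zshift add.commute flip: zshift_one)
  ultimately show ?thesis using shift_in_Xbar by (auto simp: carrier_Aut)
qed

lemma subgroup_shift_powers: "subgroup (shift_powers Xbar) (Aut A Xbar)"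
proof -
  interpret group "Aut A Xbar" by (rule group_Aut_Xbar)
  have mult: "restrict (zshift m) Xbar \<otimes>\<^bsub>Aut A Xbar\<^esub> restrict (zshift n) Xbar
      = restrict (zshift (m + n)) Xbar" for m n
    by (simp add: mult_Aut zshift_in_Aut)
      (auto simp: fun_eq_iff compose_def zshift_in zshift_zshift)
  have one: "restrict (zshift 0) Xbar = \<one>\<^bsub>Aut A Xbar\<^esub>" by (simp add: one_Aut zshift_zero)
  show ?thesis
  proof (rule subgroupI)
    show "shift_powers Xbar \<subseteq> carrier (Aut A Xbar)" using zshift_in_Aut by (auto simp: shift_powers_def)
    show "shift_powers Xbar \<noteq> {}" by (auto simp: shift_powers_def)
  next
    fix a assume "a \<in> shift_powers Xbar"
    then obtain n where n: "a = restrict (zshift n) Xbar" by (auto simp: shift_powers_def)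
    have "inv\<^bsub>Aut A Xbar\<^esub> a = restrict (zshift (-n)) Xbar"
      by (rule inv_equality) (use mult[of "-n" n] one n zshift_in_Aut in simp_all)
    then show "inv\<^bsub>Aut A Xbar\<^esub> a \<in> shift_powers Xbar" by (auto simp: shift_powers_def)
  next
    fix a b assume "a \<in> shift_powers Xbar" "b \<in> shift_powers Xbar"
    then obtain m n where "a = restrict (zshift m) Xbar" "b = restrict (zshift n) Xbar"
      by (auto simp: shift_powers_def)
    then have "a \<otimes>\<^bsub>Aut A Xbar\<^esub> b = restrict (zshift (m + n)) Xbar" using mult by simp
    then show "a \<otimes>\<^bsub>Aut A Xbar\<^esub> b \<in> shift_powers Xbar" unfolding shift_powers_def by blast
  qed
qed

lemma rcosets_shift_powers:
  assumes fin: "finite (branching X)"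
  shows "finite (rcosets\<^bsub>Aut A Xbar\<^esub> shift_powers Xbar) \<and>
    card (rcosets\<^bsub>Aut A Xbar\<^esub> shift_powers Xbar) \<le> min_count (asymptotic_classes Xbar)"
proof -
  let ?G = "Aut A Xbar" and ?H = "shift_powers Xbar"
  interpret group ?G by (rule group_Aut_Xbar)
  obtain k where k: "card (asymptotic_classes Xbar k) = min_count (asymptotic_classes Xbar)"
    "asymptotic_classes Xbar k \<noteq> {}" "finite (asymptotic_classes Xbar k)"
    using min_count_attained[OF counts_ok_asymptotic_classes[OF fin]] by metis
  then obtain P where P: "P \<in> asymptotic_orbits Xbar" "card (asym `` {P}) = k"
    by (auto simp: asymptotic_classes_def quotient_def)
  obtain x where x: "x \<in> Xbar" "P = orbit x" using P(1) by (rule asymptotic_orbitE)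
  \<comment> \<open>\<open>P\<close> lies in a class whose size \<open>k\<close> attains the
    minimum, and \<open>cls\<close> takes values among the classes of that same size. Equal values
    will yield automorphisms differing by a shift power, so there are at most as many cosets as
    classes.\<close>
  define cls where "cls \<Phi> = asym `` {\<Phi> ` P}" for \<Phi>
  have mem: "\<Phi> ` P \<in> asymptotic_orbits Xbar" if "\<Phi> \<in> carrier ?G" for \<Phi>
  proof -
    have "(P, P) \<in> asym" using equiv_asymptotic P(1) by (simp add: equiv_def refl_on_def)
    from Aut_asymptotic_rel[OF that this] show ?thesis by (simp add: asymptotic_rel_def)
  qed
  have "cls ` carrier ?G \<subseteq> asymptotic_classes Xbar k"
    using mem Aut_class_card P by (auto simp: cls_def asymptotic_classes_def intro: quotientI)
  moreover have "?H #>\<^bsub>?G\<^esub> \<Phi> = ?H #>\<^bsub>?G\<^esub> \<Psi>"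
    if PP: "\<Phi> \<in> carrier ?G" "\<Psi> \<in> carrier ?G" and eq: "cls \<Phi> = cls \<Psi>" for \<Phi> \<Psi>
  proof -
    have "(\<Phi> ` P, \<Psi> ` P) \<in> asym"
      using eq_equiv_class_iff[OF equiv_asymptotic mem[OF PP(1)] mem[OF PP(2)]] eq by (simp add: cls_def)
    then have "orbits_right_asymptotic (orbit (\<Phi> x)) (orbit (\<Psi> x))"
      by (simp add: asymptotic_rel_def x Aut_orbit[OF PP(1) x(1)] Aut_orbit[OF PP(2) x(1)])
    then obtain n where n: "right_asymptotic (\<Phi> x) (zshift n (\<Psi> x))"
      unfolding orbits_right_asymptotic_iff by blast
    define h where "h = restrict (zshift n) Xbar"
    have h: "h \<in> ?H" "h \<in> carrier ?G" using zshift_in_Aut by (auto simp: h_def shift_powers_def)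
    have "(h \<otimes>\<^bsub>?G\<^esub> \<Psi>) x = zshift n (\<Psi> x)"
      using h(2) PP(2) x(1) Aut_props(3)[OF PP(2)] by (simp add: mult_Aut compose_def h_def)
    then have "\<Phi> = h \<otimes>\<^bsub>?G\<^esub> \<Psi>"
      using n h(2) PP by (intro Aut_eq_if_right_asymptotic[OF _ _ x(1)]) simp_all
    then have "?H #>\<^bsub>?G\<^esub> \<Phi> = (?H #>\<^bsub>?G\<^esub> h) #>\<^bsub>?G\<^esub> \<Psi>"
      using coset_mult_assoc[OF subgroup.subset[OF subgroup_shift_powers] h(2) PP(2)] by simp
    also have "?H #>\<^bsub>?G\<^esub> h = ?H" by (rule coset_join2[OF h(2) subgroup_shift_powers h(1)])
    finally show ?thesis .
  qed
  ultimately have "finite ((\<lambda>\<Phi>. ?H #>\<^bsub>?G\<^esub> \<Phi>) ` carrier ?G) \<and>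
      card ((\<lambda>\<Phi>. ?H #>\<^bsub>?G\<^esub> \<Phi>) ` carrier ?G) \<le> card (asymptotic_classes Xbar k)"
    by (rule card_image_le_if_factors[OF k(3)])
  moreover have "rcosets\<^bsub>?G\<^esub> ?H = (\<lambda>\<Phi>. ?H #>\<^bsub>?G\<^esub> \<Phi>) ` carrier ?G"
    by (auto simp: RCOSETS_def)
  ultimately show ?thesis using k(1) by simp
qed

end

theorem theorem3p1:
  fixes A :: "'a set" and X :: "(nat \<Rightarrow> 'a) set" and Xbar :: "(int \<Rightarrow> 'a) set"
    and M Mbar :: nat
  assumes "finite A"
    and "one_sided_shift A X"
    and "infinite X"
    and "minimal_one_sided A X"
    and "sublinear_complexity X"
    and "Xbar = two_sided_version X"
    and "M = min_count (branch_points X)"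
    and "Mbar = min_count (asymptotic_classes Xbar)"
  shows
    "counts_ok (branch_points X) \<and>
     finite (carrier (Aut A X)) \<and> card (carrier (Aut A X)) \<le> M \<and>
     (\<forall>\<Phi>\<in>carrier (Aut A X).
        0 < group.ord (Aut A X) \<Phi> \<and> group.ord (Aut A X) \<Phi> \<le> M) \<and>
     counts_ok (asymptotic_classes Xbar) \<and>
     finite (carrier (Aut A Xbar Mod shift_powers Xbar)) \<and>
     card (carrier (Aut A Xbar Mod shift_powers Xbar)) \<le> Mbar \<and>
     (\<forall>\<Phi>\<in>carrier (Aut A Xbar). \<exists>k::nat. 1 \<le> k \<and> k \<le> Mbar \<and>
        (\<exists>n::int. \<Phi> [^]\<^bsub>Aut A Xbar\<^esub> k = restrict (zshift n) Xbar))"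
proof -
  interpret infinite_minimal_shift A X
    using assms by unfold_locales
  note fin = finite_branching[OF assms(5)]
  have "shift ` X \<subseteq> X" using shift_in by blast
  note group_AutX = group_Aut[OF finite_alphabet closed_X this]
  note card_AutX = card_Aut[OF assms(5)]
  have ord: "0 < group.ord (Aut A X) \<Phi> \<and> group.ord (Aut A X) \<Phi> \<le> M"
    if "\<Phi> \<in> carrier (Aut A X)" for \<Phi>
    using group.ord_le_card[OF group_AutX _ that] card_AutX assms(7) by fastforce
  note cosets = rcosets_shift_powers[OF fin]
  have pow: "\<exists>k::nat. 1 \<le> k \<and> k \<le> Mbar \<and>
        (\<exists>n::int. \<Phi> [^]\<^bsub>Aut A Xbar\<^esub> k = restrict (zshift n) Xbar)"
    if P: "\<Phi> \<in> carrier (Aut A Xbar)" for \<Phi>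
    using group.pow_in_subgroup_finite_index[OF group_Aut_Xbar subgroup_shift_powers
        cosets[THEN conjunct1] cosets[THEN conjunct2] P[unfolded assms(6)]]
    unfolding shift_powers_def assms(6,8) by blast
  show ?thesis
    using counts_ok_branch_points[OF assms(5)] card_AutX ord
      counts_ok_asymptotic_classes[OF fin] cosets pow
    unfolding assms(6,7,8) FactGroup_def by simp
qed

end
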